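(* For every $k\in\mathbb{N}$, the operator $S\oplus(S_k^+)^*$ is cyclic, where $S$ is the simple bilateral shift on $\ell^2(\mathbb{Z})$ and $S_k^+$ is the orthogonal sum of $k$ copies of the simple unilateral shift $S^+$ on $\ell^2(\mathbb{N}_0)$.
   Context: $Se_n=e_{n+1}$ ($n\in\mathbb{Z}$) and $S^+e_n=e_{n+1}$ ($n\in\mathbb{N}_0$) for the standard orthonormal bases. An operator $T$ on $\mathcal{H}$ is cyclic if there is $h$ with $\bigvee\{T^nh:n\in\mathbb{N}_0\}=\mathcal{H}$. *)

theory Defs
  imports "HOL-Analysis.Analysis"
begin

text \<open>Concrete model of the complex Hilbert space
  l2(Z) (+) l2(N0)^k  as square-summable functions on the index type
  int + (nat * nat): index Inl n is the basis vector e_n of l2(Z), index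
  Inr (j, n) with j < k is the basis vector e_n of the j-th copy of l2(N0).\<close>

type_synonym idx = "int + nat \<times> nat"

definition ell2_norm :: "('i \<Rightarrow> complex) \<Rightarrow> real" where
  "ell2_norm f = sqrt (\<Sum>\<^sub>\<infinity>i. (cmod (f i))\<^sup>2)"

definition H_space :: "nat \<Rightarrow> (idx \<Rightarrow> complex) set" where
  "H_space k = {f. (\<forall>j n. k \<le> j \<longrightarrow> f (Inr (j, n)) = 0)
                  \<and> (\<lambda>i. (cmod (f i))\<^sup>2) summable_on UNIV}"

text \<open>Bilateral shift S e_n = e_(n+1) on l2(Z): (S f)(n) = f(n-1).\<close>
definition bilateral_shift :: "(int \<Rightarrow> complex) \<Rightarrow> (int \<Rightarrow> complex)" where
  "bilateral_shift f = (\<lambda>n. f (n - 1))"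

text \<open>Adjoint of the unilateral shift S+ e_n = e_(n+1) on l2(N0):
  (S+)* e_n = e_(n-1), (S+)* e_0 = 0, i.e. ((S+)* f)(n) = f(n+1).\<close>
definition unilateral_shift_adj :: "(nat \<Rightarrow> complex) \<Rightarrow> (nat \<Rightarrow> complex)" where
  "unilateral_shift_adj f = (\<lambda>n. f (Suc n))"

definition T_op :: "(idx \<Rightarrow> complex) \<Rightarrow> (idx \<Rightarrow> complex)" where
  "T_op f = (\<lambda>i. case i of
       Inl n \<Rightarrow> bilateral_shift (\<lambda>m. f (Inl m)) n
     | Inr (j, n) \<Rightarrow> unilateral_shift_adj (\<lambda>m. f (Inr (j, m))) n)"

definition cyclic_op :: "('i \<Rightarrow> complex) set \<Rightarrow> (('i \<Rightarrow> complex) \<Rightarrow> ('i \<Rightarrow> complex)) \<Rightarrow> bool" where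
  "cyclic_op V T \<longleftrightarrow> (\<exists>h\<in>V. \<forall>f\<in>V. \<forall>e>0. \<exists>N::nat. \<exists>c::nat \<Rightarrow> complex.
      ell2_norm (\<lambda>i. f i - (\<Sum>m<N. c m * (T ^^ m) h i)) < e)"

end

theory Submission
  imports Defs "HOL-Complex_Analysis.Cauchy_Integral_Formula"
begin

text \<open>
  Both summands, and hence their sum \<open>T\<close>, act as \<open>f \<mapsto> f \<circ> \<sigma>\<close> with \<open>\<sigma>\<close> injective. The backward shifts
  are adjoined one at a time.

  \<^emph>\<open>Adjoining a backward shift.\<close> If \<open>g\<close> is cyclic, then \<open>g\<close> lies in the closed span of
  \<open>T g, T\<^sup>2 g, \<dots>\<close> because \<open>T\<close> is surjective, so there are polynomials \<open>p\<close> with \<open>p(0) = 1\<close> and \<open>p(T) g\<close>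
  arbitrarily small. Choose alternately such \<open>p\<^sub>i\<close> with \<open>\<parallel>p\<^sub>i(T) g\<parallel> \<le> \<epsilon>\<^sub>i\<^sup>2\<close> and \<open>\<epsilon>\<^sub>i\<^sub>+\<^sub>1\<close> so small that
  \<open>p\<^sub>i(T)\<close> maps the ball of radius \<open>2 \<epsilon>\<^sub>i\<^sub>+\<^sub>1\<close> into the ball of radius \<open>\<epsilon>\<^sub>i\<^sup>2\<close>. Let
  \<open>h = g + \<epsilon>\<^sub>0 e\<^sub>0 + \<epsilon>\<^sub>1 e\<^sub>1 + \<dots>\<close>, where the \<open>e\<^sub>n\<close> are the basis vectors of the new summand. Then
  \<open>p\<^sub>i(T) T\<^sup>i\<^sup>-\<^sup>r h / \<epsilon>\<^sub>i\<close> differs from \<open>e\<^sub>r\<close> by a combination of \<open>e\<^sub>0, \<dots>, e\<^sub>r\<^sub>-\<^sub>1\<close> and a vector of norm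
  at most \<open>2 \<epsilon>\<^sub>i\<close>. By induction on \<open>r\<close> all \<open>e\<^sub>r\<close> lie in the cyclic subspace of \<open>h\<close>, which therefore
  also contains \<open>g\<close>.

  \<^emph>\<open>The bilateral shift.\<close> Let \<open>\<phi>(z) = exp (-1 / |1 + z|\<^sup>2)\<close> on the unit circle. For
  \<open>F(w) = exp (n (1 - w) / (1 + w) - n)\<close> we have \<open>F(0) = 1\<close> and \<open>|F(r z) \<phi>(z)| \<le> exp (-n)\<close> for \<open>r < 1\<close>
  close to 1, and \<open>z \<mapsto> F(r z)\<close> is a uniform limit of its Taylor polynomials \<open>p\<close>. By Bessel's
  inequality \<open>p(S)\<close> makes the Fourier coefficients of \<open>\<phi>\<close> small, so their cyclic subspace is also
  invariant under the inverse of \<open>S\<close>. By the Stone--Weierstrass theorem it then contains the Fourier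
  coefficients of \<open>\<psi> \<phi>\<close> for every continuous \<open>\<psi>\<close>, and these are dense because \<open>\<phi>\<close> vanishes at a
  single point only.
\<close>

section \<open>Square-summable families\<close>

definition ell2 :: "('i \<Rightarrow> complex) set" where
  "ell2 = {f. (\<lambda>i. (cmod (f i))\<^sup>2) summable_on UNIV}"

definition ell2_on :: "'i set \<Rightarrow> ('i \<Rightarrow> complex) set" where
  "ell2_on J = {f \<in> ell2. \<forall>i. i \<notin> J \<longrightarrow> f i = 0}"

definition basis_vec :: "'i \<Rightarrow> 'i \<Rightarrow> complex" where
  "basis_vec i = (\<lambda>j. if j = i then 1 else 0)"

lemma ell2_norm_nonneg [simp]: "0 \<le> ell2_norm f"
  by (simp add: ell2_norm_def infsum_nonneg)

lemma ell2_norm_zero [simp]: "ell2_norm (\<lambda>i. 0) = 0"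
  by (simp add: ell2_norm_def)

lemma ell2_norm_scale: "ell2_norm (\<lambda>i. a * f i) = cmod a * ell2_norm f"
  by (simp add: ell2_norm_def norm_mult power_mult_distrib infsum_cmult_right' real_sqrt_mult)

lemma ell2_norm_uminus [simp]: "ell2_norm (\<lambda>i. - f i) = ell2_norm f"
  by (simp add: ell2_norm_def)

lemma zero_mem_ell2 [simp]: "(\<lambda>i. 0) \<in> ell2"
  by (simp add: ell2_def)

lemma scale_mem_ell2: "f \<in> ell2 \<Longrightarrow> (\<lambda>i. a * f i) \<in> ell2"
  by (simp add: ell2_def norm_mult power_mult_distrib summable_on_cmult_right)

lemma sum_le_ell2_norm:
  assumes "f \<in> ell2" "finite F"
  shows "(\<Sum>i\<in>F. (cmod (f i))\<^sup>2) \<le> (ell2_norm f)\<^sup>2"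
  using assms by (auto simp: ell2_def ell2_norm_def infsum_nonneg intro!: finite_sum_le_infsum)

lemma
  assumes sum_le: "\<And>F. finite F \<Longrightarrow> (\<Sum>i\<in>F. (cmod (f i))\<^sup>2) \<le> b\<^sup>2" and "0 \<le> b"
  shows ell2I: "f \<in> ell2" and ell2_norm_leI: "ell2_norm f \<le> b"
proof -
  have summable: "(\<lambda>i. (cmod (f i))\<^sup>2) summable_on UNIV"
    using sum_le by (intro nonneg_bdd_above_summable_on bdd_aboveI2[where M="b\<^sup>2"]) auto
  then show "f \<in> ell2" by (simp add: ell2_def)
  show "ell2_norm f \<le> b"
    unfolding ell2_norm_def using infsum_le_finite_sums[OF summable sum_le] \<open>0 \<le> b\<close>
    by (intro real_le_lsqrt) (auto simp: infsum_nonneg)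
qed

lemma
  assumes "f \<in> ell2" "inj_on \<sigma> {i. g i \<noteq> 0}"
    and "\<And>i. g i \<noteq> 0 \<Longrightarrow> cmod (g i) \<le> cmod (f (\<sigma> i))"
  shows dominated_mem_ell2: "g \<in> ell2" and dominated_ell2_norm_le: "ell2_norm g \<le> ell2_norm f"
proof -
  have "(\<Sum>i\<in>F. (cmod (g i))\<^sup>2) \<le> (ell2_norm f)\<^sup>2" if "finite F" for F
  proof -
    let ?G = "{i\<in>F. g i \<noteq> 0}"
    have inj: "inj_on \<sigma> ?G" using assms(2) by (rule inj_on_subset) auto
    have "(\<Sum>i\<in>F. (cmod (g i))\<^sup>2) = (\<Sum>i\<in>?G. (cmod (g i))\<^sup>2)"
      using that by (intro sum.mono_neutral_right) auto
    also have "\<dots> \<le> (\<Sum>i\<in>?G. (cmod (f (\<sigma> i)))\<^sup>2)"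
      using assms(3) by (intro sum_mono power_mono) auto
    also have "\<dots> = (\<Sum>i\<in>\<sigma> ` ?G. (cmod (f i))\<^sup>2)"
      by (simp add: sum.reindex[OF inj])
    also have "\<dots> \<le> (ell2_norm f)\<^sup>2"
      using assms(1) that by (intro sum_le_ell2_norm) auto
    finally show ?thesis .
  qed
  then show "g \<in> ell2" "ell2_norm g \<le> ell2_norm f"
    by (auto intro: ell2I[where b="ell2_norm f"] ell2_norm_leI)
qed

lemma
  assumes "f \<in> ell2" "g \<in> ell2"
  shows add_mem_ell2: "(\<lambda>i. f i + g i) \<in> ell2"
    and ell2_norm_triangle: "ell2_norm (\<lambda>i. f i + g i) \<le> ell2_norm f + ell2_norm g"
proof -
  have "(\<Sum>i\<in>F. (cmod (f i + g i))\<^sup>2) \<le> (ell2_norm f + ell2_norm g)\<^sup>2" if "finite F" for F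
  proof -
    have L2_set_le: "L2_set (\<lambda>i. cmod (u i)) F \<le> ell2_norm u" if "u \<in> ell2" for u
      unfolding L2_set_def using sum_le_ell2_norm[OF that \<open>finite F\<close>]
      by (intro real_le_lsqrt) (auto simp: sum_nonneg)
    have "L2_set (\<lambda>i. cmod (f i + g i)) F \<le> L2_set (\<lambda>i. cmod (f i) + cmod (g i)) F"
      by (intro L2_set_mono norm_triangle_ineq) auto
    also have "\<dots> \<le> L2_set (\<lambda>i. cmod (f i)) F + L2_set (\<lambda>i. cmod (g i)) F"
      by (rule L2_set_triangle_ineq)
    also have "\<dots> \<le> ell2_norm f + ell2_norm g"
      using L2_set_le assms by (intro add_mono) auto
    finally show ?thesis
      unfolding L2_set_def by (simp add: sqrt_le_D)
  qed
  then show "(\<lambda>i. f i + g i) \<in> ell2" "ell2_norm (\<lambda>i. f i + g i) \<le> ell2_norm f + ell2_norm g"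
    by (auto intro: ell2I[where b="ell2_norm f + ell2_norm g"] ell2_norm_leI)
qed

lemma diff_mem_ell2: "f \<in> ell2 \<Longrightarrow> g \<in> ell2 \<Longrightarrow> (\<lambda>i. f i - g i) \<in> ell2"
  using add_mem_ell2[OF _ scale_mem_ell2[of g "-1"], of f] by simp

lemma ell2_norm_triangle_sub:
  assumes "f \<in> ell2" "g \<in> ell2" "h \<in> ell2"
  shows "ell2_norm (\<lambda>i. f i - h i) \<le> ell2_norm (\<lambda>i. f i - g i) + ell2_norm (\<lambda>i. g i - h i)"
  using ell2_norm_triangle[OF diff_mem_ell2[OF assms(1,2)] diff_mem_ell2[OF assms(2,3)]] by simp

lemma basis_vec_mem_ell2 [simp]: "basis_vec i \<in> ell2"
proof (rule ell2I)
  fix F :: "'a set" assume "finite F"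
  then show "(\<Sum>j\<in>F. (cmod (basis_vec i j))\<^sup>2) \<le> 1\<^sup>2"
    by (simp add: basis_vec_def if_distrib[of "\<lambda>x. (cmod x)\<^sup>2"] cong: if_cong)
qed simp

lemma ell2_finite_approx:
  assumes "f \<in> ell2" "0 < e"
  obtains F where "finite F" "ell2_norm (\<lambda>i. if i \<in> F then 0 else f i) < e"
proof -
  let ?s = "\<lambda>i. (cmod (f i))\<^sup>2"
  have summable: "?s summable_on UNIV" using assms(1) by (simp add: ell2_def)
  have "0 < (e/2)\<^sup>2" using assms(2) by simp
  then obtain F where F: "finite F" "dist (sum ?s F) (infsum ?s UNIV) \<le> (e/2)\<^sup>2"
    using infsum_finite_approximation[OF summable] by blast
  have "(\<Sum>i\<in>G. (cmod (if i \<in> F then 0 else f i))\<^sup>2) \<le> (e/2)\<^sup>2" if "finite G" for G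
  proof -
    have "(\<Sum>i\<in>G. (cmod (if i \<in> F then 0 else f i))\<^sup>2) = sum ?s (G - F)"
      using that by (intro sum.mono_neutral_cong_right) auto
    also have "\<dots> = sum ?s (G \<union> F) - sum ?s F"
      using that F(1) by (simp add: sum_diff[symmetric] Un_Diff)
    also have "sum ?s (G \<union> F) \<le> infsum ?s UNIV"
      using that F(1) summable by (intro finite_sum_le_infsum) auto
    finally show ?thesis using F(2) by (simp add: dist_real_def)
  qed
  then have "ell2_norm (\<lambda>i. if i \<in> F then 0 else f i) \<le> e/2"
    using assms(2) by (intro ell2_norm_leI) auto
  with F(1) assms(2) show ?thesis by (intro that[of F]) auto
qed

definition push_forward :: "('j \<Rightarrow> 'i) \<Rightarrow> ('j \<Rightarrow> complex) \<Rightarrow> 'i \<Rightarrow> complex" where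
  "push_forward \<pi> f = (\<lambda>i. if i \<in> range \<pi> then f (inv \<pi> i) else 0)"

lemma push_forward_apply [simp]: "inj \<pi> \<Longrightarrow> push_forward \<pi> f (\<pi> j) = f j"
  by (simp add: push_forward_def)

lemma push_forward_outside: "i \<notin> range \<pi> \<Longrightarrow> push_forward \<pi> f i = 0"
  by (simp add: push_forward_def)

lemma
  assumes "inj \<pi>"
  shows push_forward_mem_ell2: "push_forward \<pi> f \<in> ell2 \<longleftrightarrow> f \<in> ell2"
    and ell2_norm_push_forward: "ell2_norm (push_forward \<pi> f) = ell2_norm f"
proof -
  let ?s = "\<lambda>i. (cmod (push_forward \<pi> f i))\<^sup>2"
  have comp: "?s \<circ> \<pi> = (\<lambda>j. (cmod (f j))\<^sup>2)"
    using assms by (simp add: fun_eq_iff)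
  have "?s summable_on UNIV \<longleftrightarrow> ?s summable_on range \<pi>"
    by (rule summable_on_cong_neutral) (auto simp: push_forward_outside)
  then show "push_forward \<pi> f \<in> ell2 \<longleftrightarrow> f \<in> ell2"
    by (simp add: ell2_def summable_on_reindex[OF assms] comp)
  have "infsum ?s UNIV = infsum ?s (range \<pi>)"
    by (rule infsum_cong_neutral) (auto simp: push_forward_outside)
  then show "ell2_norm (push_forward \<pi> f) = ell2_norm f"
    by (simp add: ell2_norm_def infsum_reindex[OF assms] comp)
qed

section \<open>Closed subspaces\<close>

definition ell2_closure :: "('i \<Rightarrow> complex) set \<Rightarrow> ('i \<Rightarrow> complex) set" where
  "ell2_closure A = {f \<in> ell2. \<forall>e>0. \<exists>g\<in>A. ell2_norm (\<lambda>i. f i - g i) < e}"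

lemma ell2_closureI:
  assumes "f \<in> ell2" "\<And>e. e > 0 \<Longrightarrow> \<exists>g\<in>A. ell2_norm (\<lambda>i. f i - g i) < e"
  shows "f \<in> ell2_closure A"
  using assms by (simp add: ell2_closure_def)

lemma ell2_closureE:
  assumes "f \<in> ell2_closure A" "e > 0"
  obtains g where "g \<in> A" "ell2_norm (\<lambda>i. f i - g i) < e"
  using assms by (auto simp: ell2_closure_def)

lemma ell2_closure_subset: "ell2_closure A \<subseteq> ell2"
  by (auto simp: ell2_closure_def)

lemma ell2_closure_mono: "A \<subseteq> B \<Longrightarrow> ell2_closure A \<subseteq> ell2_closure B"
  unfolding ell2_closure_def by blast

lemma subset_ell2_closure: "A \<subseteq> ell2 \<Longrightarrow> A \<subseteq> ell2_closure A"
  unfolding ell2_closure_def by (force intro: rev_bexI)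

lemma ell2_closure_idem:
  assumes "A \<subseteq> ell2"
  shows "ell2_closure (ell2_closure A) = ell2_closure A"
proof
  show "ell2_closure (ell2_closure A) \<subseteq> ell2_closure A"
  proof
    fix f assume f: "f \<in> ell2_closure (ell2_closure A)"
    then have f_mem: "f \<in> ell2" using ell2_closure_subset by blast
    then show "f \<in> ell2_closure A"
    proof (rule ell2_closureI)
      fix e :: real assume "e > 0"
      then have "e/2 > 0" by simp
      obtain g where g: "g \<in> ell2_closure A" "ell2_norm (\<lambda>i. f i - g i) < e/2"
        using f \<open>e/2 > 0\<close> by (rule ell2_closureE)
      obtain h where h: "h \<in> A" "ell2_norm (\<lambda>i. g i - h i) < e/2"
        using g(1) \<open>e/2 > 0\<close> by (rule ell2_closureE)
      have "g \<in> ell2" "h \<in> ell2" using g(1) h(1) assms ell2_closure_subset by blast+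
      then have "ell2_norm (\<lambda>i. f i - h i) < e"
        using ell2_norm_triangle_sub[OF f_mem, of g h] g(2) h(2) by simp
      with h(1) show "\<exists>h\<in>A. ell2_norm (\<lambda>i. f i - h i) < e" by blast
    qed
  qed
qed (intro subset_ell2_closure ell2_closure_subset)

lemma ell2_closure_image:
  assumes "f \<in> ell2_closure A" "A \<subseteq> ell2" "\<And>g. g \<in> A \<Longrightarrow> L g \<in> B" "L f \<in> ell2"
    and lipschitz: "\<And>g. g \<in> ell2 \<Longrightarrow> ell2_norm (\<lambda>i. L f i - L g i) \<le> K * ell2_norm (\<lambda>i. f i - g i)"
  shows "L f \<in> ell2_closure B"
proof (rule ell2_closureI)
  fix e :: real assume "e > 0"
  then have "e / (\<bar>K\<bar> + 1) > 0" by (simp add: add_nonneg_pos)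
  with assms(1) obtain g where g: "g \<in> A" "ell2_norm (\<lambda>i. f i - g i) < e / (\<bar>K\<bar> + 1)"
    by (rule ell2_closureE)
  have "ell2_norm (\<lambda>i. L f i - L g i) \<le> K * ell2_norm (\<lambda>i. f i - g i)"
    using g(1) assms(2) by (intro lipschitz) auto
  also have "\<dots> \<le> \<bar>K\<bar> * ell2_norm (\<lambda>i. f i - g i)" by (intro mult_right_mono) auto
  also have "\<dots> \<le> \<bar>K\<bar> * (e / (\<bar>K\<bar> + 1))" using g(2) by (intro mult_left_mono) auto
  also have "\<dots> < e" using \<open>e > 0\<close> by (simp add: divide_simps add_nonneg_pos)
  finally show "\<exists>h\<in>B. ell2_norm (\<lambda>i. L f i - h i) < e" using assms(3) g(1) by blast
qed (rule assms)

locale ell2_subspace =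
  fixes M :: "('i \<Rightarrow> complex) set"
  assumes subset_ell2: "M \<subseteq> ell2"
    and zero_mem: "(\<lambda>i. 0) \<in> M"
    and add_mem: "f \<in> M \<Longrightarrow> g \<in> M \<Longrightarrow> (\<lambda>i. f i + g i) \<in> M"
    and scale_mem: "f \<in> M \<Longrightarrow> (\<lambda>i. a * f i) \<in> M"
    and closure_subset: "ell2_closure M \<subseteq> M"
begin

lemma diff_mem: "f \<in> M \<Longrightarrow> g \<in> M \<Longrightarrow> (\<lambda>i. f i - g i) \<in> M"
  using add_mem[OF _ scale_mem[of g "-1"], of f] by simp

lemma mem_of_basis_vec:
  assumes "f \<in> ell2" "\<And>i. f i \<noteq> 0 \<Longrightarrow> basis_vec i \<in> M"
  shows "f \<in> M"
proof -
  have finite_part: "(\<lambda>i. if i \<in> F then f i else 0) \<in> M" if "finite F" for F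
    using that
  proof (induction F)
    case (insert j F)
    have "(\<lambda>i. f j * basis_vec j i) \<in> M"
      using assms(2) scale_mem zero_mem by (cases "f j = 0") auto
    from add_mem[OF this insert.IH]
    show ?case
      by (rule back_subst[of "\<lambda>u. u \<in> M"]) (use insert.hyps in \<open>auto simp: basis_vec_def\<close>)
  qed (use zero_mem in simp)
  have "f \<in> ell2_closure M"
  proof (rule ell2_closureI[OF assms(1)])
    fix e :: real assume "e > 0"
    then obtain F where F: "finite F" "ell2_norm (\<lambda>i. if i \<in> F then 0 else f i) < e"
      using ell2_finite_approx assms(1) by blast
    have "(\<lambda>i. f i - (if i \<in> F then f i else 0)) = (\<lambda>i. if i \<in> F then 0 else f i)" by auto
    with F finite_part show "\<exists>g\<in>M. ell2_norm (\<lambda>i. f i - g i) < e" by metis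
  qed
  then show ?thesis using closure_subset by blast
qed

end

lemma ell2_subspace_closure:
  assumes "A \<subseteq> ell2" "(\<lambda>i. 0) \<in> A"
    and add: "\<And>f g. f \<in> A \<Longrightarrow> g \<in> A \<Longrightarrow> (\<lambda>i. f i + g i) \<in> A"
    and scale: "\<And>f a. f \<in> A \<Longrightarrow> (\<lambda>i. a * f i) \<in> A"
  shows "ell2_subspace (ell2_closure A)"
proof
  have closure_mem: "f \<in> ell2" if "f \<in> ell2_closure A" for f
    using that ell2_closure_subset by blast
  show "(\<lambda>i. 0) \<in> ell2_closure A" using assms(1,2) subset_ell2_closure by blast
  show "(\<lambda>i. a * f i) \<in> ell2_closure A" if "f \<in> ell2_closure A" for f a
  proof (rule ell2_closure_image[OF that assms(1) scale, where K="cmod a"])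
    show "(\<lambda>i. a * f i) \<in> ell2" using that by (intro scale_mem_ell2 closure_mem)
    show "ell2_norm (\<lambda>i. a * f i - a * g i) \<le> cmod a * ell2_norm (\<lambda>i. f i - g i)" for g
      by (simp add: ell2_norm_scale[symmetric] right_diff_distrib)
  qed
  fix f g assume f: "f \<in> ell2_closure A" and g: "g \<in> ell2_closure A"
  show "(\<lambda>i. f i + g i) \<in> ell2_closure A"
  proof (rule ell2_closureI)
    show "(\<lambda>i. f i + g i) \<in> ell2" using f g by (intro add_mem_ell2 closure_mem)
    fix e :: real assume "e > 0"
    then have "e/2 > 0" by simp
    obtain f' where f': "f' \<in> A" "ell2_norm (\<lambda>i. f i - f' i) < e/2"
      using f \<open>e/2 > 0\<close> by (rule ell2_closureE)
    obtain g' where g': "g' \<in> A" "ell2_norm (\<lambda>i. g i - g' i) < e/2"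
      using g \<open>e/2 > 0\<close> by (rule ell2_closureE)
    have "ell2_norm (\<lambda>i. (f i - f' i) + (g i - g' i))
        \<le> ell2_norm (\<lambda>i. f i - f' i) + ell2_norm (\<lambda>i. g i - g' i)"
      using f g f'(1) g'(1) assms(1)
      by (intro ell2_norm_triangle diff_mem_ell2) (auto intro: closure_mem)
    with f'(2) g'(2) have "ell2_norm (\<lambda>i. (f i + g i) - (f' i + g' i)) < e"
      by (simp add: algebra_simps)
    then show "\<exists>h\<in>A. ell2_norm (\<lambda>i. (f i + g i) - h i) < e"
      by (rule bexI[where x="\<lambda>i. f' i + g' i"]) (rule add[OF f'(1) g'(1)])
  qed
qed (use assms(1) in \<open>simp_all add: ell2_closure_subset ell2_closure_idem\<close>)

section \<open>Polynomials in a composition operator\<close>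

definition poly_op :: "('i \<Rightarrow> 'i) \<Rightarrow> complex poly \<Rightarrow> ('i \<Rightarrow> complex) \<Rightarrow> 'i \<Rightarrow> complex" where
  "poly_op \<sigma> p f = (\<lambda>i. \<Sum>m\<le>degree p. coeff p m * f ((\<sigma> ^^ m) i))"

lemma poly_op_0 [simp]: "poly_op \<sigma> 0 f = (\<lambda>i. 0)"
  by (simp add: poly_op_def)

lemma poly_op_pCons [simp]: "poly_op \<sigma> (pCons a p) f = (\<lambda>i. a * f i + poly_op \<sigma> p f (\<sigma> i))"
proof (cases "p = 0")
  case False
  then show ?thesis
    by (simp add: poly_op_def fun_eq_iff sum.atMost_Suc_shift funpow_swap1 del: sum.atMost_Suc)
qed (simp add: poly_op_def)

lemma poly_op_add: "poly_op \<sigma> (p + q) f i = poly_op \<sigma> p f i + poly_op \<sigma> q f i"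
  by (induction p q arbitrary: i rule: poly_induct2) (simp_all add: distrib_right)

lemma poly_op_smult: "poly_op \<sigma> (smult a p) f i = a * poly_op \<sigma> p f i"
  by (induction p arbitrary: i) (simp_all add: distrib_left)

lemma poly_op_uminus: "poly_op \<sigma> (- p) f i = - poly_op \<sigma> p f i"
  using poly_op_smult[of \<sigma> "-1" p f i] by simp

lemma poly_op_add_right: "poly_op \<sigma> p (\<lambda>i. f i + g i) i = poly_op \<sigma> p f i + poly_op \<sigma> p g i"
  by (induction p arbitrary: i) (simp_all add: distrib_left)

lemma poly_op_Suc_last_entry:
  assumes "\<And>n. n > r \<Longrightarrow> f n = 0" "n \<ge> r"
  shows "poly_op Suc p f n = coeff p 0 * f n"
proof (cases p)
  case (pCons a q)
  have "poly_op Suc q f (Suc n) = 0"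
    using assms by (simp add: poly_op_def Suc_funpow)
  then show ?thesis by (simp add: pCons)
qed

lemma poly_op_push_forward:
  assumes "inj \<pi>" "\<And>j. \<sigma> (\<pi> j) = \<pi> (\<tau> j)" "\<And>i. \<sigma> i \<in> range \<pi> \<Longrightarrow> i \<in> range \<pi>"
  shows "poly_op \<sigma> p (push_forward \<pi> f) = push_forward \<pi> (poly_op \<tau> p f)"
proof (induction p)
  case (pCons a p)
  have "push_forward \<pi> u (\<sigma> i) = push_forward \<pi> (\<lambda>j. u (\<tau> j)) i" for u i
  proof (cases "i \<in> range \<pi>")
    case False
    with assms(3) have "\<sigma> i \<notin> range \<pi>" by blast
    with False show ?thesis by (simp add: push_forward_outside)
  qed (use assms in auto)
  with pCons.IH show ?case by (auto simp: push_forward_def fun_eq_iff)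
qed (simp add: push_forward_def fun_eq_iff)

lemma comp_mem_ell2: "inj \<sigma> \<Longrightarrow> f \<in> ell2 \<Longrightarrow> (\<lambda>i. f (\<sigma> i)) \<in> ell2"
  by (rule dominated_mem_ell2[where \<sigma>=\<sigma>]) (auto intro: inj_on_subset)

lemma ell2_norm_comp_le: "inj \<sigma> \<Longrightarrow> f \<in> ell2 \<Longrightarrow> ell2_norm (\<lambda>i. f (\<sigma> i)) \<le> ell2_norm f"
  by (rule dominated_ell2_norm_le[where \<sigma>=\<sigma>]) (auto intro: inj_on_subset)

lemma poly_op_mem_ell2: "inj \<sigma> \<Longrightarrow> f \<in> ell2 \<Longrightarrow> poly_op \<sigma> p f \<in> ell2"
  by (induction p) (auto intro: add_mem_ell2 scale_mem_ell2 comp_mem_ell2)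

lemma poly_op_bounded:
  assumes "inj \<sigma>"
  shows "\<exists>B>0. \<forall>f\<in>ell2. ell2_norm (poly_op \<sigma> p f) \<le> B * ell2_norm f"
proof (induction p)
  case (pCons a p)
  then obtain B where B: "B > 0" "\<And>f. f \<in> ell2 \<Longrightarrow> ell2_norm (poly_op \<sigma> p f) \<le> B * ell2_norm f"
    by blast
  have "ell2_norm (poly_op \<sigma> (pCons a p) f) \<le> (cmod a + B) * ell2_norm f" if f: "f \<in> ell2" for f
  proof -
    have p_mem: "poly_op \<sigma> p f \<in> ell2" using assms f by (rule poly_op_mem_ell2)
    have "ell2_norm (poly_op \<sigma> (pCons a p) f)
        \<le> ell2_norm (\<lambda>i. a * f i) + ell2_norm (\<lambda>i. poly_op \<sigma> p f (\<sigma> i))"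
      unfolding poly_op_pCons
      by (rule ell2_norm_triangle[OF scale_mem_ell2[OF f] comp_mem_ell2[OF assms p_mem]])
    also have "\<dots> \<le> cmod a * ell2_norm f + B * ell2_norm f"
      using ell2_norm_comp_le[OF assms p_mem] B(2)[OF f] by (simp add: ell2_norm_scale)
    finally show ?thesis by (simp add: distrib_right)
  qed
  with B(1) show ?case by (intro exI[of _ "cmod a + B"]) (auto intro: add_nonneg_pos)
qed (auto intro: exI[of _ 1])

lemma (in ell2_subspace) ell2_subspace_comp:
  assumes "inj \<tau>"
  shows "ell2_subspace {f \<in> M. (\<lambda>i. f (\<tau> i)) \<in> M}" (is "ell2_subspace ?N")
proof
  show "ell2_closure ?N \<subseteq> ?N"
  proof
    fix f assume f: "f \<in> ell2_closure ?N"
    then have "f \<in> M" using closure_subset ell2_closure_mono[of ?N M] by auto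
    then have f_mem: "f \<in> ell2" using subset_ell2 by auto
    have "(\<lambda>i. f (\<tau> i)) \<in> ell2_closure M"
    proof (rule ell2_closure_image[OF f, where K=1])
      show "ell2_norm (\<lambda>i. f (\<tau> i) - g (\<tau> i)) \<le> 1 * ell2_norm (\<lambda>i. f i - g i)"
        if "g \<in> ell2" for g
        using ell2_norm_comp_le[OF assms diff_mem_ell2[OF f_mem that]] by simp
    qed (use subset_ell2 comp_mem_ell2[OF assms f_mem] in auto)
    with \<open>f \<in> M\<close> show "f \<in> ?N" using closure_subset by auto
  qed
qed (use subset_ell2 zero_mem add_mem scale_mem in auto)

section \<open>Cyclic subspaces\<close>

definition cyclic_space :: "('i \<Rightarrow> 'i) \<Rightarrow> ('i \<Rightarrow> complex) \<Rightarrow> ('i \<Rightarrow> complex) set" where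
  "cyclic_space \<sigma> g = ell2_closure (range (\<lambda>p. poly_op \<sigma> p g))"

definition cyclic_vector :: "('i \<Rightarrow> 'i) \<Rightarrow> 'i set \<Rightarrow> ('i \<Rightarrow> complex) \<Rightarrow> bool" where
  "cyclic_vector \<sigma> J g \<longleftrightarrow> g \<in> ell2_on J \<and> ell2_on J \<subseteq> cyclic_space \<sigma> g"

lemma cyclic_op_comp:
  assumes "cyclic_vector \<sigma> J g"
  shows "cyclic_op (ell2_on J) (\<lambda>f. f \<circ> \<sigma>)"
  unfolding cyclic_op_def
proof (intro bexI ballI allI impI)
  show "g \<in> ell2_on J" using assms by (simp add: cyclic_vector_def)
  have power: "((\<lambda>f. f \<circ> \<sigma>) ^^ m) g i = g ((\<sigma> ^^ m) i)" for m i
    by (induction m arbitrary: i) (simp_all add: funpow_swap1)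
  fix f :: "'a \<Rightarrow> complex" and e :: real
  assume "f \<in> ell2_on J" "e > 0"
  then obtain p where p: "ell2_norm (\<lambda>i. f i - poly_op \<sigma> p g i) < e"
    using assms unfolding cyclic_vector_def cyclic_space_def by (blast elim: ell2_closureE)
  have "poly_op \<sigma> p g = (\<lambda>i. \<Sum>m<Suc (degree p). coeff p m * ((\<lambda>f. f \<circ> \<sigma>) ^^ m) g i)"
    by (simp add: poly_op_def power lessThan_Suc_atMost)
  with p show "\<exists>N c. ell2_norm (\<lambda>i. f i - (\<Sum>m<N. c m * ((\<lambda>f. f \<circ> \<sigma>) ^^ m) g i)) < e"
    by (intro exI[of _ "Suc (degree p)"] exI[of _ "coeff p"]) simp
qed

locale invariant_subspace = ell2_subspace M for M :: "('i \<Rightarrow> complex) set" +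
  fixes \<sigma> :: "'i \<Rightarrow> 'i"
  assumes comp_mem: "f \<in> M \<Longrightarrow> (\<lambda>i. f (\<sigma> i)) \<in> M"
begin

lemma funpow_mem: "f \<in> M \<Longrightarrow> (\<lambda>i. f ((\<sigma> ^^ m) i)) \<in> M"
proof (induction m)
  case (Suc m)
  from comp_mem[OF Suc.IH[OF Suc.prems]] show ?case by (simp add: funpow_swap1)
qed simp

lemma poly_op_mem: "f \<in> M \<Longrightarrow> poly_op \<sigma> p f \<in> M"
  by (induction p) (auto intro: zero_mem add_mem scale_mem comp_mem)

lemma cyclic_space_subset: "g \<in> M \<Longrightarrow> cyclic_space \<sigma> g \<subseteq> M"
  using ell2_closure_mono[of "range (\<lambda>p. poly_op \<sigma> p g)" M] closure_subset poly_op_mem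
  unfolding cyclic_space_def by blast

end

context
  fixes \<sigma> :: "'i \<Rightarrow> 'i" and g :: "'i \<Rightarrow> complex"
  assumes inj: "inj \<sigma>" and g: "g \<in> ell2"
begin

lemma poly_op_mem_cyclic_space: "poly_op \<sigma> p g \<in> cyclic_space \<sigma> g"
  using subset_ell2_closure[of "range (\<lambda>p. poly_op \<sigma> p g)"] poly_op_mem_ell2[OF inj g]
  unfolding cyclic_space_def by blast

lemma generator_mem_cyclic_space: "g \<in> cyclic_space \<sigma> g"
  using poly_op_mem_cyclic_space[of 1] by (simp add: one_pCons)

lemma invariant_subspace_cyclic_space: "invariant_subspace (cyclic_space \<sigma> g) \<sigma>"
proof -
  let ?A = "range (\<lambda>p. poly_op \<sigma> p g)"
  have A: "?A \<subseteq> ell2" using poly_op_mem_ell2[OF inj g] by blast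
  interpret ell2_subspace "cyclic_space \<sigma> g"
    unfolding cyclic_space_def
  proof (rule ell2_subspace_closure[OF A])
    show "(\<lambda>i. 0) \<in> ?A" by (rule range_eqI[of _ _ 0]) simp
    fix f assume "f \<in> ?A"
    then obtain p where p: "f = poly_op \<sigma> p g" by blast
    show "(\<lambda>i. a * f i) \<in> ?A" for a
      by (rule range_eqI[of _ _ "smult a p"]) (simp add: p poly_op_smult fun_eq_iff)
    fix f' assume "f' \<in> ?A"
    then obtain q where q: "f' = poly_op \<sigma> q g" by blast
    show "(\<lambda>i. f i + f' i) \<in> ?A"
      by (rule range_eqI[of _ _ "p + q"]) (simp add: p q poly_op_add fun_eq_iff)
  qed
  show ?thesis
  proof
    fix f assume f: "f \<in> cyclic_space \<sigma> g"
    then have f_mem: "f \<in> ell2" using subset_ell2 by blast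
    show "(\<lambda>i. f (\<sigma> i)) \<in> cyclic_space \<sigma> g"
      unfolding cyclic_space_def
    proof (rule ell2_closure_image[OF f[unfolded cyclic_space_def] A, where K=1])
      show "(\<lambda>i. u (\<sigma> i)) \<in> ?A" if u: "u \<in> ?A" for u
      proof -
        obtain p where "u = poly_op \<sigma> p g" using u by blast
        then show ?thesis by (intro range_eqI[of _ _ "pCons 0 p"]) simp
      qed
      show "ell2_norm (\<lambda>i. f (\<sigma> i) - u (\<sigma> i)) \<le> 1 * ell2_norm (\<lambda>i. f i - u i)" if "u \<in> ell2" for u
        using ell2_norm_comp_le[OF inj diff_mem_ell2[OF f_mem that]] by simp
    qed (rule comp_mem_ell2[OF inj f_mem])
  qed
qed

end

lemma cyclic_vector_push_forward:
  assumes "inj \<pi>" "\<And>j. \<sigma> (\<pi> j) = \<pi> (\<tau> j)" "\<And>i. \<sigma> i \<in> range \<pi> \<Longrightarrow> i \<in> range \<pi>"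
    and g: "cyclic_vector \<tau> UNIV g"
  shows "cyclic_vector \<sigma> (range \<pi>) (push_forward \<pi> g)"
  unfolding cyclic_vector_def
proof (intro conjI subsetI)
  have "g \<in> ell2" and dense: "ell2 \<subseteq> cyclic_space \<tau> g"
    using g by (auto simp: cyclic_vector_def ell2_on_def)
  then show "push_forward \<pi> g \<in> ell2_on (range \<pi>)"
    by (simp add: ell2_on_def push_forward_outside push_forward_mem_ell2[OF assms(1)])
  have intertwine: "poly_op \<sigma> p (push_forward \<pi> g) = push_forward \<pi> (poly_op \<tau> p g)" for p
    using assms(1-3) by (rule poly_op_push_forward)
  fix f assume "f \<in> ell2_on (range \<pi>)"
  then have f: "f \<in> ell2" "\<And>i. i \<notin> range \<pi> \<Longrightarrow> f i = 0" by (auto simp: ell2_on_def)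
  show "f \<in> cyclic_space \<sigma> (push_forward \<pi> g)"
    unfolding cyclic_space_def
  proof (rule ell2_closureI[OF f(1)])
    fix e :: real assume "e > 0"
    have "(\<lambda>j. f (\<pi> j)) \<in> cyclic_space \<tau> g"
      using dense comp_mem_ell2[OF assms(1) f(1)] by blast
    then obtain p where p: "ell2_norm (\<lambda>j. f (\<pi> j) - poly_op \<tau> p g j) < e"
      using \<open>e > 0\<close> unfolding cyclic_space_def by (blast elim: ell2_closureE)
    have "ell2_norm (\<lambda>i. f i - poly_op \<sigma> p (push_forward \<pi> g) i)
        = ell2_norm (push_forward \<pi> (\<lambda>j. f (\<pi> j) - poly_op \<tau> p g j))"
      unfolding intertwine using f(2)
      by (intro arg_cong[where f=ell2_norm]) (auto simp: fun_eq_iff push_forward_def f_inv_into_f)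
    also have "\<dots> < e"
      using p by (simp add: ell2_norm_push_forward[OF assms(1)])
    finally show "\<exists>h\<in>range (\<lambda>p. poly_op \<sigma> p (push_forward \<pi> g)). ell2_norm (\<lambda>i. f i - h i) < e"
      by blast
  qed
qed

section \<open>Annihilating polynomials\<close>

definition annihilable :: "('i \<Rightarrow> 'i) \<Rightarrow> ('i \<Rightarrow> complex) \<Rightarrow> bool" where
  "annihilable \<sigma> g \<longleftrightarrow> (\<forall>e>0. \<exists>p. coeff p 0 = 1 \<and> ell2_norm (poly_op \<sigma> p g) < e)"

lemma cyclic_vector_annihilable:
  assumes "inj \<sigma>" "\<And>i. \<sigma> i \<in> J \<longleftrightarrow> i \<in> J" "cyclic_vector \<sigma> J g"
  shows "annihilable \<sigma> g"
  unfolding annihilable_def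
proof (intro allI impI)
  fix e :: real assume "e > 0"
  have g: "g \<in> ell2" "\<And>i. i \<notin> J \<Longrightarrow> g i = 0"
    using assms(3) by (auto simp: cyclic_vector_def ell2_on_def)
  let ?f = "push_forward \<sigma> g"
  have "?f \<in> ell2_on J"
    using assms(1,2) g push_forward_mem_ell2
    by (auto simp: ell2_on_def push_forward_def)
  then obtain q where q: "ell2_norm (\<lambda>i. ?f i - poly_op \<sigma> q g i) < e"
    using assms(3) \<open>e > 0\<close> unfolding cyclic_vector_def cyclic_space_def
    by (blast elim: ell2_closureE)
  have "(\<lambda>i. ?f i - poly_op \<sigma> q g i) \<in> ell2"
    using assms(1) g(1) by (simp add: diff_mem_ell2 push_forward_mem_ell2 poly_op_mem_ell2)
  from ell2_norm_comp_le[OF assms(1) this] q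
  have "ell2_norm (poly_op \<sigma> (pCons 1 (- q)) g) < e"
    using assms(1) by (simp add: poly_op_uminus)
  then show "\<exists>p. coeff p 0 = 1 \<and> ell2_norm (poly_op \<sigma> p g) < e"
    by (intro exI[of _ "pCons 1 (- q)"]) simp
qed

lemma cyclic_space_comp_inverse:
  assumes "inj \<sigma>" and inverse: "\<And>i. \<sigma> (\<tau> i) = i" and "g \<in> ell2" "annihilable \<sigma> g"
    and "f \<in> cyclic_space \<sigma> g"
  shows "(\<lambda>i. f (\<tau> i)) \<in> cyclic_space \<sigma> g"
proof -
  let ?W = "cyclic_space \<sigma> g"
  interpret invariant_subspace ?W \<sigma>
    using assms(1,3) by (rule invariant_subspace_cyclic_space)
  have inj_\<tau>: "inj \<tau>" using inverse by (metis injI)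
  let ?N = "{f \<in> ?W. (\<lambda>i. f (\<tau> i)) \<in> ?W}"
  interpret N: ell2_subspace ?N using inj_\<tau> by (rule ell2_subspace_comp)
  interpret N: invariant_subspace ?N \<sigma>
    by standard (simp add: comp_mem inverse)
  have "(\<lambda>i. g (\<tau> i)) \<in> ?W"
    unfolding cyclic_space_def
  proof (rule ell2_closureI)
    show "(\<lambda>i. g (\<tau> i)) \<in> ell2" using inj_\<tau> assms(3) by (rule comp_mem_ell2)
    fix e :: real assume "e > 0"
    then obtain p where p: "coeff p 0 = 1" "ell2_norm (poly_op \<sigma> p g) < e"
      using assms(4) by (auto simp: annihilable_def)
    then obtain q where q: "p = pCons 1 q" by (cases p) auto
    have "ell2_norm (\<lambda>i. g (\<tau> i) - poly_op \<sigma> (- q) g i) = ell2_norm (\<lambda>i. poly_op \<sigma> p g (\<tau> i))"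
      by (simp add: q inverse poly_op_uminus)
    also have "\<dots> < e"
      using ell2_norm_comp_le[OF inj_\<tau> poly_op_mem_ell2[OF assms(1,3)]] p(2)
      by (rule le_less_trans)
    finally show "\<exists>h\<in>range (\<lambda>p. poly_op \<sigma> p g). ell2_norm (\<lambda>i. g (\<tau> i) - h i) < e"
      by blast
  qed
  then have "g \<in> ?N" using generator_mem_cyclic_space[OF assms(1,3)] by simp
  from N.cyclic_space_subset[OF this] assms(5) show ?thesis by auto
qed

section \<open>Adjoining a backward shift\<close>

context
  fixes \<sigma> :: "'i \<Rightarrow> 'i" and a :: 'i
  assumes inj: "inj \<sigma>" and start: "a \<notin> range \<sigma>"
begin

lemma start_not_image: "\<sigma> i \<noteq> a" "a \<noteq> \<sigma> i"
  using start by auto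

lemma inj_orbit: "inj (\<lambda>n. (\<sigma> ^^ n) a)"
proof (rule injI)
  show "m = n" if "(\<sigma> ^^ m) a = (\<sigma> ^^ n) a" for m n
    using that
  proof (induction m arbitrary: n)
    case 0
    then show ?case using start by (cases n) auto
  next
    case (Suc m)
    then show ?case by (cases n) (auto simp: start_not_image inj_eq[OF inj])
  qed
qed

lemma orbit_backward: "\<sigma> i \<in> range (\<lambda>n. (\<sigma> ^^ n) a) \<Longrightarrow> i \<in> range (\<lambda>n. (\<sigma> ^^ n) a)"
proof -
  assume "\<sigma> i \<in> range (\<lambda>n. (\<sigma> ^^ n) a)"
  then obtain n where "\<sigma> i = (\<sigma> ^^ n) a" by blast
  then show ?thesis by (cases n) (auto simp: start_not_image inj_eq[OF inj])
qed

lemma funpow_orbit_backward: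
  "(\<sigma> ^^ m) i \<in> range (\<lambda>n. (\<sigma> ^^ n) a) \<Longrightarrow> i \<in> range (\<lambda>n. (\<sigma> ^^ n) a)"
proof (induction m)
  case (Suc m)
  then show ?case using orbit_backward[of "(\<sigma> ^^ m) i"] by simp
qed simp

end

lemma half_powers_mem_ell2: "(\<lambda>n. (1/2) ^ n) \<in> ell2"
  and ell2_norm_half_powers_le: "ell2_norm (\<lambda>n. (1/2) ^ n) \<le> 2"
proof -
  have sum_le: "(\<Sum>n\<in>F. (cmod ((1/2) ^ n))\<^sup>2) \<le> 2\<^sup>2" if "finite F" for F :: "nat set"
  proof -
    have "(cmod ((1/2) ^ n))\<^sup>2 = (1/4) ^ n" for n
      by (simp add: norm_power norm_divide power2_eq_square) (simp flip: power_mult_distrib)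
    then have "(\<Sum>n\<in>F. (cmod ((1/2) ^ n))\<^sup>2) = (\<Sum>n\<in>F. (1/4::real) ^ n)" by simp
    also have "\<dots> \<le> (\<Sum>n. (1/4::real) ^ n)"
      using that by (intro sum_le_suminf summable_geometric) auto
    also have "\<dots> \<le> 2\<^sup>2" by (subst suminf_geometric) auto
    finally show ?thesis .
  qed
  show "(\<lambda>n. (1/2) ^ n) \<in> ell2" "ell2_norm (\<lambda>n. (1/2) ^ n) \<le> 2"
    by (rule ell2I[OF sum_le] ell2_norm_leI[OF sum_le]; simp)+
qed

locale gliding_hump =
  fixes \<sigma> :: "'i \<Rightarrow> 'i" and a :: 'i and g :: "'i \<Rightarrow> complex"
    and p :: "nat \<Rightarrow> complex poly" and \<epsilon> :: "nat \<Rightarrow> real"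
  assumes inj: "inj \<sigma>" and start: "a \<notin> range \<sigma>" and g: "g \<in> ell2"
    and coeff_0: "coeff (p i) 0 = 1" and \<epsilon>_pos: "\<epsilon> i > 0" and \<epsilon>_half: "\<epsilon> (Suc i) \<le> \<epsilon> i / 2"
    and annihilates: "ell2_norm (poly_op \<sigma> (p i) g) \<le> (\<epsilon> i)\<^sup>2"
    and contracts: "f \<in> ell2 \<Longrightarrow> ell2_norm f \<le> 2 * \<epsilon> (Suc i) \<Longrightarrow>
      ell2_norm (poly_op \<sigma> (p i) f) \<le> (\<epsilon> i)\<^sup>2"
begin

abbreviation orbit :: "nat \<Rightarrow> 'i" where
  "orbit n \<equiv> (\<sigma> ^^ n) a"

definition spread :: "nat set \<Rightarrow> 'i \<Rightarrow> complex" where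
  "spread A = push_forward orbit (\<lambda>n. if n \<in> A then of_real (\<epsilon> n) else 0)"

definition hump :: "'i \<Rightarrow> complex" where
  "hump = (\<lambda>x. g x + spread UNIV x)"

lemma spread_Un: "A \<inter> B = {} \<Longrightarrow> spread (A \<union> B) x = spread A x + spread B x"
  by (auto simp: spread_def push_forward_def)

lemma spread_outside: "x \<notin> range orbit \<Longrightarrow> spread A x = 0"
  by (simp add: spread_def push_forward_outside)

lemma poly_op_spread:
  "poly_op \<sigma> q (spread A)
    = push_forward orbit (poly_op Suc q (\<lambda>n. if n \<in> A then of_real (\<epsilon> n) else 0))"
  unfolding spread_def
  by (rule poly_op_push_forward[OF inj_orbit[OF inj start] _ orbit_backward[OF inj start]]) simp

lemma \<epsilon>_geometric: "\<epsilon> (i + n) \<le> \<epsilon> i * (1/2) ^ n"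
proof (induction n)
  case (Suc n)
  then show ?case using \<epsilon>_half[of "i + n"] by simp
qed simp

lemma
  assumes "A \<subseteq> {i..}"
  shows spread_mem_ell2: "spread A \<in> ell2" and ell2_norm_spread_le: "ell2_norm (spread A) \<le> 2 * \<epsilon> i"
proof -
  let ?s = "\<lambda>n. if n \<in> A then of_real (\<epsilon> n) else 0 :: complex"
  let ?f = "\<lambda>n. of_real (\<epsilon> i) * (1/2) ^ n :: complex"
  have f: "?f \<in> ell2" by (intro scale_mem_ell2 half_powers_mem_ell2)
  have inj_minus: "inj_on (\<lambda>n. n - i) {n. ?s n \<noteq> 0}"
  proof (rule inj_onI)
    fix m n assume mn: "m \<in> {n. ?s n \<noteq> 0}" "n \<in> {n. ?s n \<noteq> 0}" "m - i = n - i"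
    with assms have "i \<le> m" "i \<le> n" by (auto split: if_splits)
    with mn(3) show "m = n" by simp
  qed
  have dominated: "cmod (?s n) \<le> cmod (?f (n - i))" if "?s n \<noteq> 0" for n
  proof -
    have "n \<in> A" using that by (simp split: if_splits)
    then have "n \<ge> i" using assms by auto
    then show ?thesis
      using \<open>n \<in> A\<close> \<epsilon>_geometric[of i "n - i"] \<epsilon>_pos[of n] \<epsilon>_pos[of i]
      by (simp add: norm_mult norm_power norm_divide)
  qed
  have "?s \<in> ell2" using f inj_minus dominated by (rule dominated_mem_ell2)
  then show "spread A \<in> ell2"
    by (simp add: spread_def push_forward_mem_ell2 inj_orbit[OF inj start])
  have "ell2_norm (spread A) = ell2_norm ?s"
    by (simp add: spread_def ell2_norm_push_forward inj_orbit[OF inj start])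
  also have "\<dots> \<le> ell2_norm ?f" using f inj_minus dominated by (rule dominated_ell2_norm_le)
  also have "\<dots> \<le> \<epsilon> i * 2"
    unfolding ell2_norm_scale using \<epsilon>_pos[of i] ell2_norm_half_powers_le
    by (intro mult_mono) auto
  finally show "ell2_norm (spread A) \<le> 2 * \<epsilon> i" by simp
qed

lemma hump_mem_ell2: "hump \<in> ell2"
  unfolding hump_def by (intro add_mem_ell2 g spread_mem_ell2[of _ 0]) simp

sublocale cyclic: invariant_subspace "cyclic_space \<sigma> hump" \<sigma>
  using inj hump_mem_ell2 by (rule invariant_subspace_cyclic_space)

definition rescaled_op :: "nat \<Rightarrow> nat \<Rightarrow> ('i \<Rightarrow> complex) \<Rightarrow> 'i \<Rightarrow> complex" where
  "rescaled_op i m f = (\<lambda>x. of_real (1 / \<epsilon> i) * poly_op \<sigma> (p i) f ((\<sigma> ^^ m) x))"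

lemma rescaled_op_add:
  "rescaled_op i m (\<lambda>x. f x + f' x) x = rescaled_op i m f x + rescaled_op i m f' x"
  by (simp add: rescaled_op_def poly_op_add_right distrib_left)

lemma rescaled_op_mem_cyclic:
  "f \<in> cyclic_space \<sigma> hump \<Longrightarrow> rescaled_op i m f \<in> cyclic_space \<sigma> hump"
  unfolding rescaled_op_def by (intro cyclic.scale_mem cyclic.funpow_mem cyclic.poly_op_mem)

lemma
  assumes "f \<in> ell2"
  shows rescaled_op_mem_ell2: "rescaled_op i m f \<in> ell2"
    and ell2_norm_rescaled_op_le:
      "ell2_norm (rescaled_op i m f) \<le> ell2_norm (poly_op \<sigma> (p i) f) / \<epsilon> i"
proof -
  note inj_m = inj_fn[OF inj, of m]
  have mem: "poly_op \<sigma> (p i) f \<in> ell2" using inj assms by (rule poly_op_mem_ell2)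
  then show "rescaled_op i m f \<in> ell2"
    unfolding rescaled_op_def by (intro scale_mem_ell2 comp_mem_ell2[OF inj_m])
  have "ell2_norm (rescaled_op i m f) = ell2_norm (\<lambda>x. poly_op \<sigma> (p i) f ((\<sigma> ^^ m) x)) / \<epsilon> i"
    unfolding rescaled_op_def ell2_norm_scale using \<epsilon>_pos[of i] by (simp add: norm_divide)
  also have "\<dots> \<le> ell2_norm (poly_op \<sigma> (p i) f) / \<epsilon> i"
    using ell2_norm_comp_le[OF inj_m mem] \<epsilon>_pos[of i] by (intro divide_right_mono) auto
  finally show "ell2_norm (rescaled_op i m f) \<le> ell2_norm (poly_op \<sigma> (p i) f) / \<epsilon> i" .
qed

lemma rescaled_op_spread_eq_basis_vec:
  assumes "r \<le> i" "x \<notin> orbit ` {..<r}"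
  shows "rescaled_op i (i - r) (spread {..i}) x = basis_vec (orbit r) x"
proof (cases "x \<in> range orbit")
  case True
  let ?c = "\<lambda>n. if n \<in> {..i} then of_real (\<epsilon> n) else 0 :: complex"
  obtain q where q: "x = orbit q" using True by blast
  then have "r \<le> q" using assms(2) by (metis image_eqI lessThan_iff not_less)
  have "(\<sigma> ^^ (i - r)) x = orbit (i - r + q)" by (simp add: q funpow_add)
  then have "poly_op \<sigma> (p i) (spread {..i}) ((\<sigma> ^^ (i - r)) x) = poly_op Suc (p i) ?c (i - r + q)"
    by (simp only: poly_op_spread push_forward_apply[OF inj_orbit[OF inj start]])
  also have "\<dots> = ?c (i - r + q)"
    using assms(1) \<open>r \<le> q\<close> by (subst poly_op_Suc_last_entry[where r=i]) (auto simp: coeff_0)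
  finally show ?thesis
    using assms(1) \<open>r \<le> q\<close> \<epsilon>_pos[of i] inj_eq[OF inj_orbit[OF inj start]]
    by (auto simp: rescaled_op_def basis_vec_def q)
next
  case False
  then have "(\<sigma> ^^ (i - r)) x \<notin> range orbit" using funpow_orbit_backward[OF inj start] by blast
  then have "poly_op \<sigma> (p i) (spread {..i}) ((\<sigma> ^^ (i - r)) x) = 0"
    by (simp only: poly_op_spread push_forward_outside not_False_eq_True)
  with False show ?thesis by (auto simp: rescaled_op_def basis_vec_def)
qed

lemma basis_vec_orbit_approx:
  assumes "r \<le> i" and lower: "\<And>q. q < r \<Longrightarrow> basis_vec (orbit q) \<in> cyclic_space \<sigma> hump"
  shows "\<exists>w\<in>cyclic_space \<sigma> hump. ell2_norm (\<lambda>x. basis_vec (orbit r) x - w x) \<le> 2 * \<epsilon> i"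
proof
  let ?L = "rescaled_op i (i - r)"
  define low where "low x = ?L (spread {..i}) x - basis_vec (orbit r) x" for x
  have low: "low \<in> cyclic_space \<sigma> hump"
  proof (rule cyclic.mem_of_basis_vec)
    show "low \<in> ell2"
      unfolding low_def
      by (intro diff_mem_ell2 rescaled_op_mem_ell2 spread_mem_ell2[of _ 0] basis_vec_mem_ell2)
        simp
    show "basis_vec x \<in> cyclic_space \<sigma> hump" if "low x \<noteq> 0" for x
      using that rescaled_op_spread_eq_basis_vec[OF assms(1), of x] lower by (auto simp: low_def)
  qed
  let ?w = "\<lambda>x. ?L hump x - low x"
  show "?w \<in> cyclic_space \<sigma> hump"
    by (intro cyclic.diff_mem rescaled_op_mem_cyclic low generator_mem_cyclic_space
        inj hump_mem_ell2)
  let ?tail = "spread {Suc i..}"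
  have tail: "?tail \<in> ell2" "ell2_norm ?tail \<le> 2 * \<epsilon> (Suc i)"
    by (rule spread_mem_ell2[of _ 0] ell2_norm_spread_le; simp)+
  have "{..i} \<union> {Suc i..} = UNIV" "{..i} \<inter> {Suc i..} = {}" by auto
  then have "hump = (\<lambda>x. (g x + ?tail x) + spread {..i} x)"
    using spread_Un[of "{..i}" "{Suc i..}"] by (simp add: hump_def fun_eq_iff)
  then have "basis_vec (orbit r) x - ?w x = - (?L g x + ?L ?tail x)" for x
    by (simp add: low_def rescaled_op_add)
  then have "ell2_norm (\<lambda>x. basis_vec (orbit r) x - ?w x) = ell2_norm (\<lambda>x. ?L g x + ?L ?tail x)"
    by (simp only: ell2_norm_uminus)
  also have "\<dots> \<le> ell2_norm (?L g) + ell2_norm (?L ?tail)"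
    by (rule ell2_norm_triangle[OF rescaled_op_mem_ell2[OF g] rescaled_op_mem_ell2[OF tail(1)]])
  also have "\<dots> \<le> (\<epsilon> i)\<^sup>2 / \<epsilon> i + (\<epsilon> i)\<^sup>2 / \<epsilon> i"
    using annihilates contracts[OF tail] \<epsilon>_pos[of i]
    by (intro add_mono order_trans[OF ell2_norm_rescaled_op_le] divide_right_mono g tail(1)) auto
  also have "\<dots> = 2 * \<epsilon> i" by (simp add: power2_eq_square)
  finally show "ell2_norm (\<lambda>x. basis_vec (orbit r) x - ?w x) \<le> 2 * \<epsilon> i" .
qed

lemma \<epsilon>_arbitrarily_small:
  assumes "e > 0"
  obtains i where "r \<le> i" "2 * \<epsilon> i < e"
proof -
  have "(\<lambda>n. 2 * (\<epsilon> r * (1/2) ^ n)) \<longlonglongrightarrow> 2 * (\<epsilon> r * 0)"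
    by (intro tendsto_mult tendsto_const LIMSEQ_power_zero) simp
  then have "\<forall>\<^sub>F n in sequentially. 2 * (\<epsilon> r * (1/2) ^ n) < e"
    using assms by (intro order_tendstoD) simp_all
  then obtain n where "2 * (\<epsilon> r * (1/2) ^ n) < e"
    using eventually_happens by force
  with \<epsilon>_geometric[of r n] that[of "r + n"] show ?thesis by simp
qed

lemma basis_vec_orbit_mem_cyclic: "basis_vec (orbit r) \<in> cyclic_space \<sigma> hump"
proof (induction r rule: less_induct)
  case (less r)
  have "basis_vec (orbit r) \<in> ell2_closure (cyclic_space \<sigma> hump)"
  proof (rule ell2_closureI)
    fix e :: real assume "e > 0"
    then obtain i where i: "r \<le> i" "2 * \<epsilon> i < e" by (rule \<epsilon>_arbitrarily_small)
    with basis_vec_orbit_approx[OF i(1) less.IH]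
    show "\<exists>w\<in>cyclic_space \<sigma> hump. ell2_norm (\<lambda>x. basis_vec (orbit r) x - w x) < e"
      by (meson le_less_trans)
  qed simp
  then show ?case using cyclic.closure_subset by blast
qed

lemma g_mem_cyclic: "g \<in> cyclic_space \<sigma> hump"
proof -
  have "spread UNIV \<in> cyclic_space \<sigma> hump"
  proof (rule cyclic.mem_of_basis_vec)
    fix x assume "spread UNIV x \<noteq> 0"
    then have "x \<in> range orbit" using spread_outside by blast
    then show "basis_vec x \<in> cyclic_space \<sigma> hump" using basis_vec_orbit_mem_cyclic by auto
  qed (rule spread_mem_ell2[of _ 0], simp)
  then have "(\<lambda>x. hump x - spread UNIV x) \<in> cyclic_space \<sigma> hump"
    by (intro cyclic.diff_mem generator_mem_cyclic_space inj hump_mem_ell2)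
  then show ?thesis by (simp add: hump_def)
qed

lemma cyclic_vector_hump:
  assumes "cyclic_vector \<sigma> J g"
  shows "cyclic_vector \<sigma> (J \<union> range orbit) hump"
  unfolding cyclic_vector_def
proof (intro conjI subsetI)
  show "hump \<in> ell2_on (J \<union> range orbit)"
    using assms hump_mem_ell2
    by (auto simp: cyclic_vector_def ell2_on_def hump_def spread_outside)
  fix f assume "f \<in> ell2_on (J \<union> range orbit)"
  then have f: "f \<in> ell2" "\<And>x. f x \<noteq> 0 \<Longrightarrow> x \<notin> J \<Longrightarrow> x \<in> range orbit"
    by (auto simp: ell2_on_def)
  define on_J where "on_J x = (if x \<in> J then f x else 0)" for x
  have "on_J \<in> ell2"
    by (rule dominated_mem_ell2[OF f(1), where \<sigma>=id]) (simp_all add: on_J_def)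
  then have "on_J \<in> ell2_on J" by (simp add: ell2_on_def on_J_def)
  then have on_J: "on_J \<in> cyclic_space \<sigma> hump"
    using assms cyclic.cyclic_space_subset[OF g_mem_cyclic] unfolding cyclic_vector_def by blast
  have "(\<lambda>x. f x - on_J x) \<in> cyclic_space \<sigma> hump"
  proof (rule cyclic.mem_of_basis_vec)
    show "(\<lambda>x. f x - on_J x) \<in> ell2"
      using f(1) \<open>on_J \<in> ell2\<close> by (rule diff_mem_ell2)
    fix x assume "f x - on_J x \<noteq> 0"
    then have "x \<in> range orbit" using f(2)[of x] by (simp add: on_J_def split: if_splits)
    then show "basis_vec x \<in> cyclic_space \<sigma> hump" using basis_vec_orbit_mem_cyclic by auto
  qed
  from cyclic.add_mem[OF on_J this] show "f \<in> cyclic_space \<sigma> hump" by simp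
qed

end

lemma annihilable_gliding_hump:
  assumes "inj \<sigma>" "a \<notin> range \<sigma>" "g \<in> ell2" "annihilable \<sigma> g"
  obtains p \<epsilon> where "gliding_hump \<sigma> a g p \<epsilon>"
proof -
  obtain P where P: "\<And>\<delta>. \<delta> > 0 \<Longrightarrow> coeff (P \<delta>) 0 = 1"
    "\<And>\<delta>. \<delta> > 0 \<Longrightarrow> ell2_norm (poly_op \<sigma> (P \<delta>) g) < \<delta>"
    using assms(4) unfolding annihilable_def by metis
  obtain B where B: "\<And>q. B q > 0"
    "\<And>q f. f \<in> ell2 \<Longrightarrow> ell2_norm (poly_op \<sigma> q f) \<le> B q * ell2_norm f"
    using poly_op_bounded[OF assms(1)] by metis
  define next_\<epsilon> where "next_\<epsilon> x = min (x / 2) (x\<^sup>2 / (2 * B (P (x\<^sup>2))))" for x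
  define \<epsilon> where "\<epsilon> i = (next_\<epsilon> ^^ i) 1" for i
  have pos: "\<epsilon> i > 0" for i
    by (induction i) (simp_all add: \<epsilon>_def next_\<epsilon>_def B(1))
  have step: "\<epsilon> (Suc i) \<le> \<epsilon> i / 2" "2 * \<epsilon> (Suc i) * B (P ((\<epsilon> i)\<^sup>2)) \<le> (\<epsilon> i)\<^sup>2" for i
  proof -
    have "\<epsilon> (Suc i) = next_\<epsilon> (\<epsilon> i)" by (simp add: \<epsilon>_def)
    then show "\<epsilon> (Suc i) \<le> \<epsilon> i / 2" by (simp add: next_\<epsilon>_def)
    have "\<epsilon> (Suc i) \<le> (\<epsilon> i)\<^sup>2 / (2 * B (P ((\<epsilon> i)\<^sup>2)))"
      using \<open>\<epsilon> (Suc i) = next_\<epsilon> (\<epsilon> i)\<close> by (simp add: next_\<epsilon>_def)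
    then show "2 * \<epsilon> (Suc i) * B (P ((\<epsilon> i)\<^sup>2)) \<le> (\<epsilon> i)\<^sup>2"
      using B(1) by (simp add: pos_le_divide_eq mult_ac)
  qed
  have "gliding_hump \<sigma> a g (\<lambda>i. P ((\<epsilon> i)\<^sup>2)) \<epsilon>"
  proof
    fix i
    have "(\<epsilon> i)\<^sup>2 > 0" using pos[of i] by simp
    then show "coeff (P ((\<epsilon> i)\<^sup>2)) 0 = 1" "ell2_norm (poly_op \<sigma> (P ((\<epsilon> i)\<^sup>2)) g) \<le> (\<epsilon> i)\<^sup>2"
      using P by (simp_all add: less_imp_le)
    fix f :: "'a \<Rightarrow> complex" assume f: "f \<in> ell2" "ell2_norm f \<le> 2 * \<epsilon> (Suc i)"
    have "ell2_norm (poly_op \<sigma> (P ((\<epsilon> i)\<^sup>2)) f) \<le> B (P ((\<epsilon> i)\<^sup>2)) * ell2_norm f"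
      using f(1) by (rule B(2))
    also have "\<dots> \<le> B (P ((\<epsilon> i)\<^sup>2)) * (2 * \<epsilon> (Suc i))"
      using f(2) B(1) by (intro mult_left_mono) (auto simp: less_imp_le)
    also have "\<dots> \<le> (\<epsilon> i)\<^sup>2" using step(2)[of i] by (simp add: mult_ac)
    finally show "ell2_norm (poly_op \<sigma> (P ((\<epsilon> i)\<^sup>2)) f) \<le> (\<epsilon> i)\<^sup>2" .
  qed (rule assms pos step)+
  then show ?thesis by (rule that)
qed

theorem cyclic_vector_adjoin_orbit:
  assumes "inj \<sigma>" "\<And>i. \<sigma> i \<in> J \<longleftrightarrow> i \<in> J" "a \<notin> range \<sigma>" "cyclic_vector \<sigma> J g"
  obtains h where "cyclic_vector \<sigma> (J \<union> range (\<lambda>n. (\<sigma> ^^ n) a)) h"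
proof -
  have "g \<in> ell2" using assms(4) by (simp add: cyclic_vector_def ell2_on_def)
  moreover have "annihilable \<sigma> g"
    using assms(1,2,4) by (rule cyclic_vector_annihilable)
  ultimately obtain p \<epsilon> where "gliding_hump \<sigma> a g p \<epsilon>"
    using annihilable_gliding_hump[OF assms(1,3)] by blast
  from gliding_hump.cyclic_vector_hump[OF this assms(4)] show ?thesis by (rule that)
qed

section \<open>Fourier coefficients of continuous functions on the circle\<close>

abbreviation circle :: "complex set" where
  "circle \<equiv> sphere 0 1"

definition circle_mean :: "(complex \<Rightarrow> 'a::euclidean_space) \<Rightarrow> 'a" where
  "circle_mean f = integral {0..2*pi} (\<lambda>t. f (cis t)) /\<^sub>R (2*pi)"

definition fourier :: "(complex \<Rightarrow> complex) \<Rightarrow> int \<Rightarrow> complex" where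
  "fourier f n = circle_mean (\<lambda>z. f z * z powi (- n))"

lemma circle_mean_integrable:
  fixes f :: "complex \<Rightarrow> 'a::euclidean_space"
  assumes "continuous_on circle f"
  shows "(\<lambda>t. f (cis t)) integrable_on {0..2*pi}"
  by (intro integrable_continuous_interval continuous_on_compose2[OF assms] continuous_intros) auto

lemma circle_mean_cong: "(\<And>z. cmod z = 1 \<Longrightarrow> f z = g z) \<Longrightarrow> circle_mean f = circle_mean g"
  by (simp add: circle_mean_def)

lemma circle_mean_add:
  fixes f g :: "complex \<Rightarrow> 'a::euclidean_space"
  assumes "continuous_on circle f" "continuous_on circle g"
  shows "circle_mean (\<lambda>z. f z + g z) = circle_mean f + circle_mean g"
  by (simp add: circle_mean_def integral_add circle_mean_integrable assms scaleR_add_right)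

lemma circle_mean_linear:
  fixes f :: "complex \<Rightarrow> 'a::euclidean_space" and h :: "'a \<Rightarrow> 'b::euclidean_space"
  assumes "bounded_linear h" "continuous_on circle f"
  shows "circle_mean (\<lambda>z. h (f z)) = h (circle_mean f)"
  using integral_linear[OF circle_mean_integrable[OF assms(2)] assms(1)]
  by (simp add: circle_mean_def o_def linear_simps[OF assms(1)])

lemma circle_mean_sum:
  fixes f :: "'b \<Rightarrow> complex \<Rightarrow> 'a::euclidean_space"
  assumes "finite F" "\<And>n. n \<in> F \<Longrightarrow> continuous_on circle (f n)"
  shows "circle_mean (\<lambda>z. \<Sum>n\<in>F. f n z) = (\<Sum>n\<in>F. circle_mean (f n))"
  using assms by (simp add: circle_mean_def integral_sum circle_mean_integrable scaleR_sum_right)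

lemma circle_mean_mono:
  fixes f g :: "complex \<Rightarrow> real"
  assumes "continuous_on circle f" "continuous_on circle g" "\<And>z. cmod z = 1 \<Longrightarrow> f z \<le> g z"
  shows "circle_mean f \<le> circle_mean g"
  using assms(3)
    integral_le[OF circle_mean_integrable[OF assms(1)] circle_mean_integrable[OF assms(2)]]
  by (simp add: circle_mean_def divide_right_mono)

lemma circle_mean_const [simp]: "circle_mean (\<lambda>z. c) = c"
  by (simp add: circle_mean_def)

lemma circle_mean_tendsto_zero:
  fixes u :: "nat \<Rightarrow> complex \<Rightarrow> real"
  assumes cont: "\<And>k. continuous_on circle (u k)" and bound: "\<And>k z. cmod z = 1 \<Longrightarrow> \<bar>u k z\<bar> \<le> B"
    and "negligible N" and lim: "\<And>t. t \<notin> N \<Longrightarrow> (\<lambda>k. u k (cis t)) \<longlonglongrightarrow> 0"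
  shows "(\<lambda>k. circle_mean (u k)) \<longlonglongrightarrow> 0"
proof -
  let ?v = "\<lambda>k t. if t \<in> N then 0 else u k (cis t)"
  have integral_eq: "integral {0..2*pi} (\<lambda>t. u k (cis t)) = integral {0..2*pi} (?v k)" for k
    using \<open>negligible N\<close> by (rule integral_spike) simp
  have "(\<lambda>k. integral {0..2*pi} (?v k)) \<longlonglongrightarrow> integral {0..2*pi} (\<lambda>t. 0)"
  proof (rule dominated_convergence)
    show "?v k integrable_on {0..2*pi}" for k
      using circle_mean_integrable[OF cont[of k]] \<open>negligible N\<close> by (rule integrable_spike) simp
    show "(\<lambda>t. B) integrable_on {0..2*pi}" by (rule integrable_const_ivl)
    show "norm (?v k t) \<le> B" for k t
      using bound[of "cis t" k] order_trans[OF abs_ge_zero bound[of "cis t" k]] by simp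
    show "(\<lambda>k. ?v k t) \<longlonglongrightarrow> 0" for t
      using lim[of t] by (cases "t \<in> N") simp_all
  qed
  from tendsto_scaleR[OF tendsto_const[of "inverse (2*pi)"] this]
  show ?thesis by (simp add: circle_mean_def integral_eq)
qed

lemma continuous_on_circle_bounded:
  fixes f :: "complex \<Rightarrow> complex"
  assumes "continuous_on circle f"
  obtains B where "B > 0" "\<And>z. cmod z = 1 \<Longrightarrow> cmod (f z) \<le> B"
proof -
  have "bounded (f ` circle)"
    using assms by (intro compact_imp_bounded compact_continuous_image compact_sphere)
  then obtain B where "B > 0" "\<forall>w\<in>f ` circle. cmod w \<le> B" by (auto simp: bounded_pos)
  with that show ?thesis by simp
qed

lemma continuous_on_circle_powi [continuous_intros]: "continuous_on circle (\<lambda>z. z powi n)"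
  by (intro continuous_intros) auto

lemma circle_mean_powi: "circle_mean (\<lambda>z. z powi n) = (if n = 0 then 1 else 0)"
proof (cases "n = 0")
  case False
  let ?F = "\<lambda>t. cis (of_int n * t) / (\<i> * of_int n)"
  have "((\<lambda>t. cis (of_int n * t)) has_integral (?F (2*pi) - ?F 0)) {0..2*pi}"
  proof (rule fundamental_theorem_of_calculus)
    show "(?F has_vector_derivative cis (of_int n * t)) (at t within {0..2*pi})" for t
      unfolding cis_conv_exp using False
      by (auto intro!: derivative_eq_intros has_vector_derivative_real_field simp: mult_ac)
  qed simp
  moreover have "?F (2*pi) = ?F 0"
    using cis_multiple_2pi[of "of_int n"] by (simp add: mult.commute mult.left_commute)
  ultimately show ?thesis
    using False by (simp add: circle_mean_def cis_power_int integral_unique)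
qed simp

lemma powi_minus_on_circle:
  assumes "cmod z = 1"
  shows "z powi (- n) = cnj (z powi n)"
proof -
  have "inverse z = cnj z"
    using assms by (simp add: inverse_complex_def complex_eq_iff cmod_power2[symmetric])
  then show ?thesis by (simp add: power_int_minus flip: power_int_inverse)
qed

lemma fourier_cong: "(\<And>z. cmod z = 1 \<Longrightarrow> f z = g z) \<Longrightarrow> fourier f = fourier g"
  unfolding fourier_def by (intro ext circle_mean_cong) simp

lemma fourier_add:
  assumes "continuous_on circle f" "continuous_on circle g"
  shows "fourier (\<lambda>z. f z + g z) n = fourier f n + fourier g n"
  unfolding fourier_def distrib_right by (intro circle_mean_add continuous_intros assms)

lemma fourier_scale:
  assumes "continuous_on circle f"
  shows "fourier (\<lambda>z. a * f z) n = a * fourier f n"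
  unfolding fourier_def mult.assoc
  by (intro circle_mean_linear bounded_linear_mult_right continuous_intros assms)

lemma fourier_diff:
  assumes "continuous_on circle f" "continuous_on circle g"
  shows "fourier (\<lambda>z. f z - g z) = (\<lambda>n. fourier f n - fourier g n)"
proof
  fix n
  have "continuous_on circle (\<lambda>z. - 1 * g z)" by (intro continuous_intros assms)
  from fourier_add[OF assms(1) this]
  show "fourier (\<lambda>z. f z - g z) n = fourier f n - fourier g n"
    using fourier_scale[OF assms(2), of "-1"] by simp
qed

lemma fourier_powi_mult: "fourier (\<lambda>z. z powi k * f z) n = fourier f (n - k)"
  unfolding fourier_def
proof (rule circle_mean_cong)
  fix z :: complex assume "cmod z = 1"
  then have "z powi k * z powi (- n) = z powi (- (n - k))"
    by (subst power_int_add[symmetric]) auto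
  then show "z powi k * f z * z powi (- n) = f z * z powi (- (n - k))"
    by (simp add: mult_ac)
qed

lemma fourier_powi: "fourier (\<lambda>z. z powi k) = basis_vec k"
  using fourier_powi_mult[of k "\<lambda>z. 1"]
  by (auto simp: fun_eq_iff basis_vec_def fourier_def circle_mean_powi)

lemma fourier_poly_mult:
  assumes "continuous_on circle f"
  shows "fourier (\<lambda>z. poly p z * f z) = poly_op (\<lambda>n. n - 1) p (fourier f)"
proof (induction p)
  case 0
  then show ?case by (simp add: fourier_def fun_eq_iff)
next
  case (pCons a p)
  have "fourier (\<lambda>z. poly (pCons a p) z * f z) n
      = fourier (\<lambda>z. a * f z + z powi 1 * (poly p z * f z)) n" for n
    by (simp add: algebra_simps)
  also have "\<dots> n = a * fourier f n + fourier (\<lambda>z. poly p z * f z) (n - 1)" for n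
    unfolding fourier_powi_mult[of 1, symmetric]
    by (subst fourier_add, (intro continuous_intros assms)+) (simp add: fourier_scale[OF assms])
  finally show ?case by (simp add: pCons.IH fun_eq_iff)
qed

lemma circle_mean_mult_cnj_trig:
  assumes "continuous_on circle f" "finite F"
  shows "circle_mean (\<lambda>z. f z * cnj (\<Sum>n\<in>F. a n * z powi n)) = (\<Sum>n\<in>F. cnj (a n) * fourier f n)"
proof -
  have "circle_mean (\<lambda>z. f z * cnj (\<Sum>n\<in>F. a n * z powi n))
      = circle_mean (\<lambda>z. \<Sum>n\<in>F. cnj (a n) * (f z * z powi (- n)))"
    by (intro circle_mean_cong) (simp add: sum_distrib_left powi_minus_on_circle mult_ac)
  also have "\<dots> = (\<Sum>n\<in>F. circle_mean (\<lambda>z. cnj (a n) * (f z * z powi (- n))))"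
    by (intro circle_mean_sum continuous_intros assms)
  also have "\<dots> = (\<Sum>n\<in>F. cnj (a n) * fourier f n)"
    unfolding fourier_def
    by (intro sum.cong refl circle_mean_linear bounded_linear_mult_right continuous_intros assms)
  finally show ?thesis .
qed

lemma fourier_trig:
  assumes "finite F"
  shows "fourier (\<lambda>z. \<Sum>n\<in>F. a n * z powi n) m = (if m \<in> F then a m else 0)"
proof -
  have "fourier (\<lambda>z. \<Sum>n\<in>F. a n * z powi n) m = (\<Sum>n\<in>F. fourier (\<lambda>z. a n * z powi n) m)"
    unfolding fourier_def sum_distrib_right by (intro circle_mean_sum continuous_intros assms)
  also have "\<dots> = (\<Sum>n\<in>F. a n * basis_vec n m)"
    by (intro sum.cong refl) (simp add: fourier_scale[OF continuous_on_circle_powi] fourier_powi)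
  also have "\<dots> = (if m \<in> F then a m else 0)"
    using assms by (simp add: basis_vec_def if_distrib[of "\<lambda>x. _ * x"] cong: if_cong)
  finally show ?thesis .
qed

lemma fourier_bessel:
  assumes f: "continuous_on circle f" and "finite F"
  shows "(\<Sum>n\<in>F. (cmod (fourier f n))\<^sup>2) \<le> circle_mean (\<lambda>z. (cmod (f z))\<^sup>2)"
proof -
  define s where "s z = (\<Sum>n\<in>F. fourier f n * z powi n)" for z
  define S where "S = (\<Sum>n\<in>F. (cmod (fourier f n))\<^sup>2)"
  have s: "continuous_on circle s" unfolding s_def by (intro continuous_intros)
  have "circle_mean (\<lambda>z. u z * cnj (s z)) = of_real S"
    if "continuous_on circle u" "\<And>n. n \<in> F \<Longrightarrow> fourier u n = fourier f n" for u
    using circle_mean_mult_cnj_trig[OF that(1) \<open>finite F\<close>] that(2)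
    by (simp add: s_def S_def complex_norm_square mult.commute del: of_real_power)
  then have mean_f_s: "circle_mean (\<lambda>z. f z * cnj (s z)) = of_real S"
    and mean_s_s: "circle_mean (\<lambda>z. s z * cnj (s z)) = of_real S"
    using f s fourier_trig[OF \<open>finite F\<close>] by (auto simp: s_def)
  let ?u = "\<lambda>z. s z * cnj (s z) + - 2 * (f z * cnj (s z))"
  have "circle_mean ?u
      = circle_mean (\<lambda>z. s z * cnj (s z)) + - 2 * circle_mean (\<lambda>z. f z * cnj (s z))"
    by (subst circle_mean_add, (intro continuous_intros f s)+)
      (subst circle_mean_linear[OF bounded_linear_mult_right],
        (intro continuous_intros f s)+, rule refl)
  also have "\<dots> = of_real (- S)" by (simp add: mean_f_s mean_s_s)
  finally have mean_u: "circle_mean (\<lambda>z. Re (?u z)) = - S"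
    by (subst circle_mean_linear[OF bounded_linear_Re], (intro continuous_intros f s)+) simp
  have norm_diff: "(cmod (f z - s z))\<^sup>2 = (cmod (f z))\<^sup>2 + Re (?u z)" for z
    unfolding cmod_power2 by (simp add: power2_eq_square algebra_simps)
  have "circle_mean (\<lambda>z. 0::real) \<le> circle_mean (\<lambda>z. (cmod (f z - s z))\<^sup>2)"
    by (intro circle_mean_mono continuous_intros f s) simp
  also have "\<dots> = circle_mean (\<lambda>z. (cmod (f z))\<^sup>2) - S"
    unfolding norm_diff
    by (subst circle_mean_add, (intro continuous_intros f s)+)
      (simp only: mean_u diff_conv_add_uminus)
  finally show ?thesis by (simp add: S_def)
qed

lemma
  assumes "continuous_on circle f"
  shows fourier_mem_ell2: "fourier f \<in> ell2"
    and ell2_norm_fourier_le: "ell2_norm (fourier f) \<le> sqrt (circle_mean (\<lambda>z. (cmod (f z))\<^sup>2))"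
proof -
  have nonneg: "0 \<le> circle_mean (\<lambda>z. (cmod (f z))\<^sup>2)"
    using fourier_bessel[OF assms, of "{}"] by simp
  with fourier_bessel[OF assms]
  have sum_le: "(\<Sum>n\<in>F. (cmod (fourier f n))\<^sup>2) \<le> (sqrt (circle_mean (\<lambda>z. (cmod (f z))\<^sup>2)))\<^sup>2"
    if "finite F" for F
    using that by simp
  show "fourier f \<in> ell2" "ell2_norm (fourier f) \<le> sqrt (circle_mean (\<lambda>z. (cmod (f z))\<^sup>2))"
    using ell2I[OF sum_le] ell2_norm_leI[OF sum_le] nonneg by simp_all
qed

lemma ell2_norm_fourier_le_bound:
  assumes "continuous_on circle f" "\<And>z. cmod z = 1 \<Longrightarrow> cmod (f z) \<le> B"
  shows "ell2_norm (fourier f) \<le> B"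
proof -
  have "B \<ge> 0" using order_trans[OF norm_ge_zero assms(2)[of 1]] by simp
  have "circle_mean (\<lambda>z. (cmod (f z))\<^sup>2) \<le> circle_mean (\<lambda>z. B\<^sup>2)"
    using assms by (intro circle_mean_mono continuous_intros power_mono) auto
  then have "sqrt (circle_mean (\<lambda>z. (cmod (f z))\<^sup>2)) \<le> B"
    using \<open>B \<ge> 0\<close> by (intro real_le_lsqrt) simp_all
  with ell2_norm_fourier_le[OF assms(1)] show ?thesis by (rule order_trans)
qed

section \<open>Reducing subspaces of the bilateral shift\<close>

text \<open>A continuous substitute for \<open>f / \<phi>\<close>, which is unbounded near the zeros of \<open>\<phi>\<close>.\<close>

definition regularized_quotient ::
  "real \<Rightarrow> (complex \<Rightarrow> complex) \<Rightarrow> (complex \<Rightarrow> complex) \<Rightarrow> complex \<Rightarrow> complex" where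
  "regularized_quotient \<delta> f \<phi> z = f z * cnj (\<phi> z) / of_real ((cmod (\<phi> z))\<^sup>2 + \<delta>)"

lemma continuous_on_regularized_quotient:
  assumes "\<delta> > 0" "continuous_on S f" "continuous_on S \<phi>"
  shows "continuous_on S (regularized_quotient \<delta> f \<phi>)"
proof -
  have "of_real ((cmod (\<phi> z))\<^sup>2 + \<delta>) \<noteq> (0::complex)" for z
    using assms(1) add_nonneg_pos[of "(cmod (\<phi> z))\<^sup>2" \<delta>] unfolding of_real_eq_0_iff by simp
  then show ?thesis
    unfolding regularized_quotient_def by (intro continuous_intros assms(2,3)) blast
qed

lemma norm_regularized_quotient_remainder:
  assumes "\<delta> > 0"
  shows "cmod (f z - regularized_quotient \<delta> f \<phi> z * \<phi> z)
    = cmod (f z) * (\<delta> / ((cmod (\<phi> z))\<^sup>2 + \<delta>))"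
proof -
  define D where "D = (cmod (\<phi> z))\<^sup>2 + \<delta>"
  have "D > 0" using assms by (simp add: D_def add_nonneg_pos)
  have "of_real D = \<phi> z * cnj (\<phi> z) + of_real \<delta>"
    by (simp add: D_def complex_norm_square del: of_real_power)
  then have "f z * of_real D - f z * cnj (\<phi> z) * \<phi> z = f z * of_real \<delta>"
    by (simp add: algebra_simps)
  moreover have "f z - f z * cnj (\<phi> z) / of_real D * \<phi> z
      = (f z * of_real D - f z * cnj (\<phi> z) * \<phi> z) / of_real D"
    using \<open>D > 0\<close> by (simp add: diff_divide_distrib)
  ultimately have "f z - regularized_quotient \<delta> f \<phi> z * \<phi> z = f z * of_real \<delta> / of_real D"
    by (simp only: regularized_quotient_def D_def)
  then show ?thesis using assms \<open>D > 0\<close> by (simp add: norm_mult norm_divide flip: D_def)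
qed

lemma regularized_quotient_remainder_tendsto_zero:
  assumes f: "continuous_on circle f"
    and \<phi>: "continuous_on circle \<phi>" "negligible {t. \<phi> (cis t) = 0}"
  shows "(\<lambda>k. circle_mean (\<lambda>z.
    (cmod (f z - regularized_quotient (inverse (real (Suc k))) f \<phi> z * \<phi> z))\<^sup>2)) \<longlonglongrightarrow> 0"
proof -
  define \<delta> where "\<delta> k = inverse (real (Suc k))" for k
  have \<delta>: "\<delta> k > 0" for k by (simp add: \<delta>_def)
  define r where "r k z = f z - regularized_quotient (\<delta> k) f \<phi> z * \<phi> z" for k z
  have norm_r: "cmod (r k z) = cmod (f z) * (\<delta> k / ((cmod (\<phi> z))\<^sup>2 + \<delta> k))" for k z
    unfolding r_def using \<delta> by (rule norm_regularized_quotient_remainder)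
  obtain B where B: "B > 0" "\<And>z. cmod z = 1 \<Longrightarrow> cmod (f z) \<le> B"
    using continuous_on_circle_bounded[OF f] by blast
  have "(\<lambda>k. circle_mean (\<lambda>z. (cmod (r k z))\<^sup>2)) \<longlonglongrightarrow> 0"
  proof (rule circle_mean_tendsto_zero[OF _ _ \<phi>(2)])
    show "continuous_on circle (\<lambda>z. (cmod (r k z))\<^sup>2)" for k
      unfolding r_def by (intro continuous_intros f \<phi>(1) continuous_on_regularized_quotient \<delta>)
    show "\<bar>(cmod (r k z))\<^sup>2\<bar> \<le> B\<^sup>2" if "cmod z = 1" for k z
    proof -
      have "cmod (r k z) \<le> B * 1"
        unfolding norm_r using B(2)[OF that] B(1) \<delta>[of k]
        by (intro mult_mono) (auto simp: divide_le_eq_1 add_nonneg_pos)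
      then show ?thesis by (simp add: power_mono)
    qed
    show "(\<lambda>k. (cmod (r k (cis t)))\<^sup>2) \<longlonglongrightarrow> 0" if "t \<notin> {t. \<phi> (cis t) = 0}" for t
    proof -
      let ?p = "(cmod (\<phi> (cis t)))\<^sup>2"
      have "\<delta> \<longlonglongrightarrow> 0" unfolding \<delta>_def by (rule LIMSEQ_inverse_real_of_nat)
      then have "(\<lambda>k. (cmod (f (cis t)) * (\<delta> k / (?p + \<delta> k)))\<^sup>2)
          \<longlonglongrightarrow> (cmod (f (cis t)) * (0 / (?p + 0)))\<^sup>2"
        using that
        by (intro tendsto_power tendsto_mult tendsto_divide tendsto_add tendsto_const) simp_all
      then show ?thesis by (simp add: norm_r)
    qed
  qed
  then show ?thesis by (simp only: r_def \<delta>_def)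
qed

locale reducing_subspace = ell2_subspace W for W :: "(int \<Rightarrow> complex) set" +
  assumes forward: "f \<in> W \<Longrightarrow> (\<lambda>n. f (n - 1)) \<in> W"
    and backward: "f \<in> W \<Longrightarrow> (\<lambda>n. f (n + 1)) \<in> W"
begin

definition multiplier :: "(complex \<Rightarrow> complex) \<Rightarrow> bool" where
  "multiplier \<psi> \<longleftrightarrow> continuous_on circle \<psi> \<and>
    (\<forall>f. continuous_on circle f \<longrightarrow> fourier f \<in> W \<longrightarrow> fourier (\<lambda>z. \<psi> z * f z) \<in> W)"

lemma multiplierI:
  assumes "continuous_on circle \<psi>"
    and "\<And>f. continuous_on circle f \<Longrightarrow> fourier f \<in> W \<Longrightarrow> fourier (\<lambda>z. \<psi> z * f z) \<in> W"
  shows "multiplier \<psi>"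
  using assms by (simp add: multiplier_def)

lemma multiplier_continuous: "multiplier \<psi> \<Longrightarrow> continuous_on circle \<psi>"
  by (simp add: multiplier_def)

lemma multiplier_mem:
  "multiplier \<psi> \<Longrightarrow> continuous_on circle f \<Longrightarrow> fourier f \<in> W \<Longrightarrow> fourier (\<lambda>z. \<psi> z * f z) \<in> W"
  by (simp add: multiplier_def)

lemma multiplier_cong:
  assumes "multiplier \<psi>" "\<And>z. cmod z = 1 \<Longrightarrow> \<psi> z = \<eta> z"
  shows "multiplier \<eta>"
proof (rule multiplierI)
  show "continuous_on circle \<eta>"
    using multiplier_continuous[OF assms(1)] by (rule continuous_on_eq) (simp add: assms(2))
  fix f assume f: "continuous_on circle f" "fourier f \<in> W"
  have "fourier (\<lambda>z. \<eta> z * f z) = fourier (\<lambda>z. \<psi> z * f z)"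
    by (rule fourier_cong) (simp add: assms(2))
  with multiplier_mem[OF assms(1) f] show "fourier (\<lambda>z. \<eta> z * f z) \<in> W" by simp
qed

lemma multiplier_const: "multiplier (\<lambda>z. c)"
proof (rule multiplierI)
  fix f assume f: "continuous_on circle f" "fourier f \<in> W"
  have "fourier (\<lambda>z. c * f z) = (\<lambda>n. c * fourier f n)"
    using f(1) by (intro ext fourier_scale)
  with f(2) show "fourier (\<lambda>z. c * f z) \<in> W" by (simp add: scale_mem)
qed simp

lemma multiplier_add:
  assumes "multiplier \<psi>" "multiplier \<eta>"
  shows "multiplier (\<lambda>z. \<psi> z + \<eta> z)"
proof (rule multiplierI)
  note cont = multiplier_continuous[OF assms(1)] multiplier_continuous[OF assms(2)]
  then show "continuous_on circle (\<lambda>z. \<psi> z + \<eta> z)" by (rule continuous_on_add)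
  fix f assume f: "continuous_on circle f" "fourier f \<in> W"
  have "fourier (\<lambda>z. (\<psi> z + \<eta> z) * f z)
      = (\<lambda>n. fourier (\<lambda>z. \<psi> z * f z) n + fourier (\<lambda>z. \<eta> z * f z) n)"
    unfolding distrib_right by (intro ext fourier_add continuous_on_mult cont f(1))
  with assms f show "fourier (\<lambda>z. (\<psi> z + \<eta> z) * f z) \<in> W"
    by (simp add: add_mem multiplier_mem)
qed

lemma multiplier_mult:
  assumes "multiplier \<psi>" "multiplier \<eta>"
  shows "multiplier (\<lambda>z. \<psi> z * \<eta> z)"
proof (rule multiplierI)
  note cont = multiplier_continuous[OF assms(1)] multiplier_continuous[OF assms(2)]
  then show "continuous_on circle (\<lambda>z. \<psi> z * \<eta> z)" by (rule continuous_on_mult)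
  fix f assume f: "continuous_on circle f" "fourier f \<in> W"
  from multiplier_mem[OF assms(1) continuous_on_mult[OF cont(2) f(1)] multiplier_mem[OF assms(2) f]]
  show "fourier (\<lambda>z. \<psi> z * \<eta> z * f z) \<in> W" by (simp add: mult.assoc)
qed

lemma multiplier_id: "multiplier (\<lambda>z. z)"
proof (rule multiplierI)
  fix f assume "fourier f \<in> W"
  moreover have "fourier (\<lambda>z. z * f z) = (\<lambda>n. fourier f (n - 1))"
    using fourier_powi_mult[of 1 f] by (simp add: fun_eq_iff)
  ultimately show "fourier (\<lambda>z. z * f z) \<in> W" by (simp add: forward)
qed simp

lemma multiplier_cnj: "multiplier cnj"
proof (rule multiplierI)
  fix f assume "fourier f \<in> W"
  have "fourier (\<lambda>z. cnj z * f z) = fourier (\<lambda>z. z powi (- 1) * f z)"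
    by (rule fourier_cong) (simp only: powi_minus_on_circle power_int_1_right)
  also have "\<dots> = (\<lambda>n. fourier f (n + 1))"
    by (simp only: fun_eq_iff fourier_powi_mult) simp
  finally show "fourier (\<lambda>z. cnj z * f z) \<in> W"
    using \<open>fourier f \<in> W\<close> by (simp add: backward)
qed (rule continuous_on_cnj, simp)

lemma multiplier_Re: "multiplier (\<lambda>z. of_real (Re z))"
proof (rule multiplier_cong)
  show "multiplier (\<lambda>z. (1/2) * (z + cnj z))"
    by (intro multiplier_mult multiplier_add multiplier_const multiplier_id multiplier_cnj)
qed (simp add: complex_add_cnj)

lemma multiplier_Im: "multiplier (\<lambda>z. of_real (Im z))"
proof (rule multiplier_cong)
  show "multiplier (\<lambda>z. (- \<i> / 2) * (z + - 1 * cnj z))"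
    by (intro multiplier_mult multiplier_add multiplier_const multiplier_id multiplier_cnj)
qed (simp add: complex_eq_iff)

lemma multiplier_uniform_limit:
  assumes "continuous_on circle \<psi>"
    and approx: "\<And>e. e > 0 \<Longrightarrow> \<exists>\<eta>. multiplier \<eta> \<and> (\<forall>z\<in>circle. cmod (\<psi> z - \<eta> z) < e)"
  shows "multiplier \<psi>"
proof (rule multiplierI[OF assms(1)])
  fix f assume f: "continuous_on circle f" "fourier f \<in> W"
  obtain B where B: "B > 0" "\<And>z. cmod z = 1 \<Longrightarrow> cmod (f z) \<le> B"
    using continuous_on_circle_bounded[OF f(1)] by blast
  have "fourier (\<lambda>z. \<psi> z * f z) \<in> ell2_closure W"
  proof (rule ell2_closureI)
    show "fourier (\<lambda>z. \<psi> z * f z) \<in> ell2"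
      by (intro fourier_mem_ell2 continuous_on_mult assms(1) f(1))
    fix e :: real assume "e > 0"
    then have "e / (2 * B) > 0" using B(1) by simp
    then obtain \<eta> where \<eta>: "multiplier \<eta>" "\<And>z. z \<in> circle \<Longrightarrow> cmod (\<psi> z - \<eta> z) < e / (2 * B)"
      using approx by blast
    note cont = continuous_on_mult[OF assms(1) f(1)]
      continuous_on_mult[OF multiplier_continuous[OF \<eta>(1)] f(1)]
    have "ell2_norm (fourier (\<lambda>z. \<psi> z * f z - \<eta> z * f z)) \<le> e / 2"
    proof (rule ell2_norm_fourier_le_bound)
      show "continuous_on circle (\<lambda>z. \<psi> z * f z - \<eta> z * f z)"
        using cont by (rule continuous_on_diff)
      fix z :: complex assume "cmod z = 1"
      then have "cmod (\<psi> z - \<eta> z) * cmod (f z) \<le> e / (2 * B) * B"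
        using \<eta>(2)[of z] B \<open>e > 0\<close> by (intro mult_mono) auto
      also have "\<dots> = e / 2" using B(1) by simp
      finally show "cmod (\<psi> z * f z - \<eta> z * f z) \<le> e / 2"
        by (simp add: norm_mult flip: left_diff_distrib)
    qed
    also have "e / 2 < e" using \<open>e > 0\<close> by simp
    finally have "ell2_norm (\<lambda>n. fourier (\<lambda>z. \<psi> z * f z) n - fourier (\<lambda>z. \<eta> z * f z) n) < e"
      by (simp only: fourier_diff[OF cont])
    then show "\<exists>u\<in>W. ell2_norm (\<lambda>n. fourier (\<lambda>z. \<psi> z * f z) n - u n) < e"
      using multiplier_mem[OF \<eta>(1) f] by (rule bexI)
  qed
  then show "fourier (\<lambda>z. \<psi> z * f z) \<in> W" using closure_subset by blast
qed

lemma multiplier_real: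
  fixes q :: "complex \<Rightarrow> real"
  assumes "continuous_on circle q"
  shows "multiplier (\<lambda>z. of_real (q z))"
proof (rule multiplier_uniform_limit)
  show "continuous_on circle (\<lambda>z. complex_of_real (q z))" using assms by (intro continuous_intros)
  fix e :: real assume "e > 0"
  have "\<exists>r. multiplier (\<lambda>z. of_real (r z)) \<and> (\<forall>z\<in>circle. \<bar>q z - r z\<bar> < e)"
  proof (rule Stone_Weierstrass_HOL[OF compact_sphere _ _ _ _ _ assms \<open>e > 0\<close>])
    show "multiplier (\<lambda>z. of_real c)" for c by (rule multiplier_const)
    show "continuous_on circle r" if "multiplier (\<lambda>z. of_real (r z))" for r
      using continuous_on_Re[OF multiplier_continuous[OF that]] by simp
    show "multiplier (\<lambda>z. of_real (r z + s z))"
      if "multiplier (\<lambda>z. of_real (r z)) \<and> multiplier (\<lambda>z. of_real (s z))" for r s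
      using that by (simp add: multiplier_add)
    show "multiplier (\<lambda>z. of_real (r z * s z))"
      if "multiplier (\<lambda>z. of_real (r z)) \<and> multiplier (\<lambda>z. of_real (s z))" for r s
      using that by (simp add: multiplier_mult)
    show "\<exists>r. multiplier (\<lambda>z. of_real (r z)) \<and> r z \<noteq> r w"
      if "z \<in> circle \<and> w \<in> circle \<and> z \<noteq> w" for z w
      using that multiplier_Re multiplier_Im complex_eq_iff by blast
  qed
  then show "\<exists>\<eta>. multiplier \<eta> \<and> (\<forall>z\<in>circle. cmod (of_real (q z) - \<eta> z) < e)"
    by (metis norm_of_real of_real_diff)
qed

lemma multiplier_of_continuous:
  assumes "continuous_on circle \<psi>"
  shows "multiplier \<psi>"
proof (rule multiplier_cong)
  show "multiplier (\<lambda>z. of_real (Re (\<psi> z)) + \<i> * of_real (Im (\<psi> z)))"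
    using assms
    by (intro multiplier_add multiplier_mult multiplier_const multiplier_real continuous_intros)
qed (simp add: complex_eq_iff)

lemma fourier_mem_of_nonvanishing:
  assumes \<phi>: "continuous_on circle \<phi>" "negligible {t. \<phi> (cis t) = 0}" "fourier \<phi> \<in> W"
    and f: "continuous_on circle f"
  shows "fourier f \<in> W"
proof -
  let ?\<psi> = "\<lambda>k. regularized_quotient (inverse (real (Suc k))) f \<phi>"
  let ?r = "\<lambda>k z. f z - ?\<psi> k z * \<phi> z"
  have cont_\<psi>: "continuous_on circle (?\<psi> k)" for k
    using f \<phi>(1) by (intro continuous_on_regularized_quotient) simp_all
  have cont_r: "continuous_on circle (?r k)" for k
    by (intro continuous_intros f \<phi>(1) cont_\<psi>)
  have "fourier f \<in> ell2_closure W"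
  proof (rule ell2_closureI)
    show "fourier f \<in> ell2" using f by (rule fourier_mem_ell2)
    fix e :: real assume "e > 0"
    then have "\<forall>\<^sub>F k in sequentially. circle_mean (\<lambda>z. (cmod (?r k z))\<^sup>2) < e\<^sup>2"
      by (intro order_tendstoD(2)[OF regularized_quotient_remainder_tendsto_zero[OF f \<phi>(1,2)]]) simp
    from eventually_happens'[OF sequentially_bot this]
    obtain k where "circle_mean (\<lambda>z. (cmod (?r k z))\<^sup>2) < e\<^sup>2" by blast
    then have "sqrt (circle_mean (\<lambda>z. (cmod (?r k z))\<^sup>2)) < e"
      using \<open>e > 0\<close> by (intro real_less_lsqrt) simp_all
    from le_less_trans[OF ell2_norm_fourier_le[OF cont_r] this]
    have "ell2_norm (\<lambda>n. fourier f n - fourier (\<lambda>z. ?\<psi> k z * \<phi> z) n) < e"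
      by (simp only: fourier_diff[OF f continuous_on_mult[OF cont_\<psi> \<phi>(1)]])
    then show "\<exists>u\<in>W. ell2_norm (\<lambda>n. fourier f n - u n) < e"
      using multiplier_mem[OF multiplier_of_continuous[OF cont_\<psi>] \<phi>(1,3)] by (rule bexI)
  qed
  then show ?thesis using closure_subset by blast
qed

theorem ell2_subset_of_nonvanishing:
  assumes "continuous_on circle \<phi>" "negligible {t. \<phi> (cis t) = 0}" "fourier \<phi> \<in> W"
  shows "ell2 \<subseteq> W"
proof
  fix f :: "int \<Rightarrow> complex" assume "f \<in> ell2"
  moreover have "basis_vec n \<in> W" for n
    unfolding fourier_powi[symmetric]
    by (rule fourier_mem_of_nonvanishing[OF assms continuous_on_circle_powi])
  ultimately show "f \<in> W" by (rule mem_of_basis_vec)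
qed

end

section \<open>A cyclic vector of the bilateral shift\<close>

lemma holomorphic_polynomial_approx:
  assumes "f holomorphic_on ball 0 R" "0 < r" "r < R" "e > 0"
  obtains p where "coeff p 0 = f 0" "\<And>z. cmod z \<le> r \<Longrightarrow> cmod (f z - poly p z) < e"
proof -
  define a where "a n = (deriv ^^ n) f 0 / fact n" for n
  have sums: "(\<lambda>n. a n * w ^ n) sums f w" if "cmod w < R" for w
    using holomorphic_power_series[OF assms(1), of w] that by (simp add: a_def)
  obtain \<rho> where \<rho>: "r < \<rho>" "\<rho> < R" using dense[OF assms(3)] by blast
  then have "summable (\<lambda>n. a n * of_real \<rho> ^ n)"
    using sums[of "of_real \<rho>"] assms(2) by (simp add: sums_iff)
  then have "ereal \<rho> \<le> conv_radius a"
    using conv_radius_geI[of a "of_real \<rho>"] assms(2) \<rho>(1) by simp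
  moreover have "ereal r < ereal \<rho>" using \<rho>(1) by simp
  ultimately have "ereal r < conv_radius a" by (rule less_le_trans[rotated])
  then have "uniform_limit (cball 0 r)
      (\<lambda>n x. \<Sum>i<n. a i * (x - 0) ^ i) (\<lambda>x. \<Sum>i. a i * (x - 0) ^ i) sequentially"
    by (rule powser_uniform_limit)
  then have "\<forall>\<^sub>F n in sequentially. \<forall>x\<in>cball 0 r.
      dist (\<Sum>i<n. a i * (x - 0) ^ i) (\<Sum>i. a i * (x - 0) ^ i) < e"
    using assms(4) unfolding uniform_limit_iff by blast
  from eventually_happens'[OF sequentially_bot eventually_conj[OF this eventually_gt_at_top[of 0]]]
  obtain N where N: "N > 0" "\<And>x. cmod x \<le> r \<Longrightarrow> dist (\<Sum>i<N. a i * x ^ i) (\<Sum>i. a i * x ^ i) < e"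
    by auto
  define p where "p = (\<Sum>i<N. monom (a i) i)"
  have poly_p: "poly p z = (\<Sum>i<N. a i * z ^ i)" for z
    by (simp add: p_def poly_sum poly_monom)
  show ?thesis
  proof (rule that)
    show "coeff p 0 = f 0" using N(1) by (simp add: p_def coeff_sum a_def)
    fix z :: complex assume z: "cmod z \<le> r"
    then have "(\<Sum>i. a i * z ^ i) = f z" using sums[of z] assms(3) by (simp add: sums_iff)
    with N(2)[OF z] show "cmod (f z - poly p z) < e"
      by (simp add: poly_p dist_norm norm_minus_commute)
  qed
qed

definition weight :: "complex \<Rightarrow> complex" where
  "weight z = (if z = -1 then 0 else of_real (exp (- 1 / (cmod (1 + z))\<^sup>2)))"

lemma norm_weight_le_1: "cmod (weight z) \<le> 1"
  by (simp add: weight_def)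

lemma norm_weight_le_square: "cmod (weight z) \<le> (cmod (1 + z))\<^sup>2"
proof (cases "z = -1")
  case False
  define s where "s = (cmod (1 + z))\<^sup>2"
  have "s > 0" using False by (simp add: s_def add_eq_0_iff)
  have "1 / s \<le> exp (1 / s)" using exp_ge_add_one_self[of "1 / s"] by linarith
  then have "inverse (exp (1 / s)) \<le> inverse (1 / s)"
    using \<open>s > 0\<close> by (intro le_imp_inverse_le) simp_all
  then have "exp (- 1 / s) \<le> s" by (simp add: exp_minus)
  then show ?thesis using False by (simp add: weight_def s_def)
qed (simp add: weight_def)

lemma continuous_on_weight: "continuous_on A weight"
proof (rule continuous_at_imp_continuous_on, rule ballI)
  show "isCont weight z" for z
  proof (cases "z = -1")
    case True
    have "((\<lambda>z. (cmod (1 + z))\<^sup>2) \<longlongrightarrow> (cmod (1 + (-1)))\<^sup>2) (at (-1))" by (intro tendsto_intros)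
    then have "((\<lambda>z. (cmod (1 + z))\<^sup>2) \<longlongrightarrow> 0) (at (-1))" by simp
    then have "(weight \<longlongrightarrow> 0) (at (-1))"
      by (rule Lim_null_comparison[rotated]) (simp add: norm_weight_le_square)
    moreover have "weight (-1) = 0" by (simp add: weight_def)
    ultimately show ?thesis by (simp add: True continuous_at)
  next
    case False
    have "continuous_on (- {-1}) (\<lambda>z. of_real (exp (- 1 / (cmod (1 + z))\<^sup>2)) :: complex)"
      by (intro continuous_intros) (auto simp: add_eq_0_iff)
    then have "continuous_on (- {-1}) weight" by (rule continuous_on_eq) (simp add: weight_def)
    with False show ?thesis by (simp add: continuous_on_eq_continuous_at open_Compl)
  qed
qed

lemma negligible_zeros_weight: "negligible {t. weight (cis t) = 0}"
proof -
  have "\<exists>n::int. t = (2 * of_int n + 1) * pi" if "cis t = -1" for t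
    using that cos_eq_minus1[of t] by (simp add: complex_eq_iff)
  then have "{t. weight (cis t) = 0} \<subseteq> range (\<lambda>n::int. (2 * of_int n + 1) * pi)"
    by (auto simp: weight_def split: if_splits)
  then have "countable {t. weight (cis t) = 0}" by (rule countable_subset) simp
  then show ?thesis
    by (simp add: negligible_iff_null_sets null_sets_completionI countable_imp_null_set_lborel)
qed

definition damping :: "real \<Rightarrow> complex \<Rightarrow> complex" where
  "damping n w = exp (of_real n * ((1 - w) / (1 + w) - 1))"

lemma damping_holomorphic: "damping n holomorphic_on ball 0 1"
proof -
  have "1 + w \<noteq> 0" if "w \<in> ball 0 1" for w :: complex
    using that by (auto simp: add_eq_0_iff)
  then show ?thesis unfolding damping_def by (intro holomorphic_intros) auto
qed

lemma Re_cayley: "Re ((1 - w) / (1 + w)) = (1 - (cmod w)\<^sup>2) / (cmod (1 + w))\<^sup>2"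
  unfolding Re_divide cmod_power2 by (simp add: power2_eq_square algebra_simps)

lemma norm_one_plus_dilate_ge:
  assumes "cmod z = 1"
  shows "r * (cmod (1 + z))\<^sup>2 \<le> (cmod (1 + of_real r * z))\<^sup>2"
proof -
  have "(Re z)\<^sup>2 + (Im z)\<^sup>2 = 1" using assms by (metis cmod_power2 one_power2)
  then have "(cmod (1 + of_real r * z))\<^sup>2 - r * (cmod (1 + z))\<^sup>2 = (1 - r)\<^sup>2"
    unfolding cmod_power2 by simp algebra
  then show ?thesis using zero_le_power2[of "1 - r"] by linarith
qed

lemma norm_damping_mult_weight_le:
  assumes "cmod z = 1" "0 < r" "r < 1" "n * (1 - r\<^sup>2) \<le> r"
  shows "cmod (damping n (of_real r * z) * weight z) \<le> exp (- n)"
proof (cases "z = -1")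
  case False
  define s where "s = (cmod (1 + z))\<^sup>2"
  let ?w = "of_real r * z"
  have "s > 0" using False by (simp add: s_def add_eq_0_iff)
  have norm_ge: "r * s \<le> (cmod (1 + ?w))\<^sup>2"
    unfolding s_def using assms(1) by (rule norm_one_plus_dilate_ge)
  have "n * Re ((1 - ?w) / (1 + ?w)) = n * (1 - r\<^sup>2) / (cmod (1 + ?w))\<^sup>2"
    using assms(1,2) by (simp add: Re_cayley norm_mult)
  also have "\<dots> \<le> r / (cmod (1 + ?w))\<^sup>2" using assms(4) by (rule divide_right_mono) simp
  also have "\<dots> \<le> r / (r * s)"
    using norm_ge assms(2) \<open>s > 0\<close> less_le_trans[OF mult_pos_pos norm_ge]
    by (intro divide_left_mono mult_pos_pos) simp_all
  also have "\<dots> = 1 / s" using assms(2) by simp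
  finally have exponent_le: "(n * Re ((1 - ?w) / (1 + ?w)) - n) + - 1 / s \<le> - n" by simp
  have "Re (of_real n * (c - 1)) = n * Re c - n" for c
    by (simp add: right_diff_distrib)
  then have "cmod (damping n ?w) = exp (n * Re ((1 - ?w) / (1 + ?w)) - n)"
    by (simp only: damping_def norm_exp_eq_Re)
  moreover have "cmod (weight z) = exp (- 1 / s)"
    using False by (simp add: weight_def s_def)
  ultimately have "cmod (damping n ?w * weight z)
      = exp ((n * Re ((1 - ?w) / (1 + ?w)) - n) + - 1 / s)"
    by (simp only: norm_mult exp_add)
  with exponent_le show ?thesis by simp
qed (simp add: weight_def)

lemma weight_annihilated:
  assumes "e > 0"
  obtains p where "coeff p 0 = 1" "\<And>z. cmod z = 1 \<Longrightarrow> cmod (poly p z * weight z) \<le> e"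
proof -
  obtain m where "ln (2 / e) < real m" using reals_Archimedean2 by blast
  define n where "n = real (Suc m)"
  have "ln (2 / e) < n" using \<open>ln (2 / e) < real m\<close> by (simp add: n_def)
  then have "exp (ln (2 / e)) < exp n" by simp
  then have "2 / e < exp n" using assms by simp
  then have exp_n: "exp (- n) < e / 2" using assms by (simp add: exp_minus field_simps)
  define r where "r = 2 * n / (2 * n + 1)"
  have r: "0 < r" "r < 1" "2 * n * (1 - r) = r" by (auto simp: r_def n_def field_simps)
  have "n * (1 - r\<^sup>2) = (1 + r) / 2 * (2 * n * (1 - r))"
    by (simp add: power2_eq_square algebra_simps)
  also have "\<dots> \<le> 1 * r" unfolding r(3) using r(1,2) by (intro mult_right_mono) auto
  finally have n_r: "n * (1 - r\<^sup>2) \<le> r" by simp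
  let ?f = "\<lambda>z. damping n (of_real r * z)"
  have "?f holomorphic_on ball 0 (1 / r)"
    by (rule holomorphic_on_compose_gen[OF _ damping_holomorphic, unfolded o_def])
      (auto intro!: holomorphic_intros
        simp: norm_mult abs_of_pos[OF r(1)] pos_less_divide_eq[OF r(1)] mult.commute)
  then obtain p where p: "coeff p 0 = ?f 0" "\<And>z. cmod z \<le> 1 \<Longrightarrow> cmod (?f z - poly p z) < e / 2"
    using r assms by (elim holomorphic_polynomial_approx[of _ "1 / r" 1 "e / 2"]) auto
  show ?thesis
  proof (rule that)
    show "coeff p 0 = 1" by (simp add: p(1) damping_def)
    fix z :: complex assume z: "cmod z = 1"
    have "cmod (poly p z * weight z) = cmod (?f z * weight z - (?f z - poly p z) * weight z)"
      by (simp add: algebra_simps)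
    also have "\<dots> \<le> cmod (?f z * weight z) + cmod (?f z - poly p z) * cmod (weight z)"
      unfolding norm_mult[symmetric] by (rule norm_triangle_ineq4)
    also have "\<dots> \<le> exp (- n) + e / 2 * 1"
      using norm_damping_mult_weight_le[OF z r(1,2) n_r] p(2)[of z] z norm_weight_le_1[of z] assms
      by (intro add_mono mult_mono) auto
    also have "\<dots> \<le> e" using exp_n by simp
    finally show "cmod (poly p z * weight z) \<le> e" .
  qed
qed

lemma annihilable_fourier_weight: "annihilable (\<lambda>n. n - 1) (fourier weight)"
  unfolding annihilable_def
proof (intro allI impI)
  fix e :: real assume "e > 0"
  then have "e / 2 > 0" by simp
  then obtain p where p: "coeff p 0 = 1" "\<And>z. cmod z = 1 \<Longrightarrow> cmod (poly p z * weight z) \<le> e / 2"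
    using weight_annihilated by blast
  have "ell2_norm (fourier (\<lambda>z. poly p z * weight z)) \<le> e / 2"
    using p(2) by (intro ell2_norm_fourier_le_bound continuous_intros continuous_on_weight)
  with \<open>e > 0\<close> have "ell2_norm (poly_op (\<lambda>n. n - 1) p (fourier weight)) < e"
    by (simp add: fourier_poly_mult[OF continuous_on_weight])
  with p(1) show "\<exists>p. coeff p 0 = 1 \<and> ell2_norm (poly_op (\<lambda>n. n - 1) p (fourier weight)) < e"
    by blast
qed

lemma cyclic_vector_fourier:
  assumes "continuous_on circle \<phi>" "negligible {t. \<phi> (cis t) = 0}"
    and "annihilable (\<lambda>n. n - 1) (fourier \<phi>)"
  shows "cyclic_vector (\<lambda>n. n - 1) UNIV (fourier \<phi>)"
proof -
  have inj: "inj (\<lambda>n::int. n - 1)" by (simp add: inj_def)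
  note mem = fourier_mem_ell2[OF assms(1)]
  interpret invariant_subspace "cyclic_space (\<lambda>n. n - 1) (fourier \<phi>)" "\<lambda>n. n - 1"
    using inj mem by (rule invariant_subspace_cyclic_space)
  interpret reducing_subspace "cyclic_space (\<lambda>n. n - 1) (fourier \<phi>)"
  proof
    show "(\<lambda>n. f (n + 1)) \<in> cyclic_space (\<lambda>n. n - 1) (fourier \<phi>)"
      if "f \<in> cyclic_space (\<lambda>n. n - 1) (fourier \<phi>)" for f
      by (rule cyclic_space_comp_inverse[OF inj _ mem assms(3) that]) simp
  qed (rule comp_mem)
  have "ell2 \<subseteq> cyclic_space (\<lambda>n. n - 1) (fourier \<phi>)"
    using assms(1,2) generator_mem_cyclic_space[OF inj mem] by (rule ell2_subset_of_nonvanishing)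
  with mem show ?thesis by (simp add: cyclic_vector_def ell2_on_def)
qed

section \<open>The bilateral shift plus copies of the backward shift\<close>

definition idx_shift :: "idx \<Rightarrow> idx" where
  "idx_shift i = (case i of Inl n \<Rightarrow> Inl (n - 1) | Inr (j, n) \<Rightarrow> Inr (j, Suc n))"

definition idx_set :: "nat \<Rightarrow> idx set" where
  "idx_set k = range Inl \<union> {Inr (j, n) | j n. j < k}"

lemma T_op_eq_comp: "T_op = (\<lambda>f. f \<circ> idx_shift)"
  by (auto simp: fun_eq_iff T_op_def idx_shift_def bilateral_shift_def unilateral_shift_adj_def
      split: sum.split)

lemma H_space_eq_ell2_on: "H_space k = ell2_on (idx_set k)"
proof -
  have "i \<in> idx_set k \<longleftrightarrow> (\<forall>j n. k \<le> j \<longrightarrow> i \<noteq> Inr (j, n))" for i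
    by (cases i) (auto simp: idx_set_def not_le)
  then show ?thesis by (auto simp: H_space_def ell2_on_def ell2_def)
qed

lemma inj_idx_shift: "inj idx_shift"
  by (auto intro!: injI simp: idx_shift_def split: sum.splits)

lemma idx_shift_mem_idx_set: "idx_shift i \<in> idx_set k \<longleftrightarrow> i \<in> idx_set k"
  by (auto simp: idx_shift_def idx_set_def split: sum.splits)

lemma idx_set_Suc: "idx_set (Suc k) = idx_set k \<union> range (\<lambda>n. (idx_shift ^^ n) (Inr (k, 0)))"
proof -
  have "(idx_shift ^^ n) (Inr (k, 0)) = Inr (k, n)" for n
    by (induction n) (simp_all add: idx_shift_def)
  then show ?thesis by (auto simp: idx_set_def less_Suc_eq)
qed

lemma cyclic_vector_idx_shift: "\<exists>g. cyclic_vector idx_shift (idx_set k) g"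
proof (induction k)
  case 0
  have "cyclic_vector idx_shift (range Inl) (push_forward Inl (fourier weight))"
    using continuous_on_weight negligible_zeros_weight annihilable_fourier_weight
    by (intro cyclic_vector_push_forward[where \<tau>="\<lambda>n. n - 1"] cyclic_vector_fourier)
      (auto simp: idx_shift_def split: sum.splits)
  then show ?case by (auto simp: idx_set_def)
next
  case (Suc k)
  then obtain g where g: "cyclic_vector idx_shift (idx_set k) g" by blast
  have "Inr (k, 0) \<notin> range idx_shift"
    by (auto simp: idx_shift_def split: sum.splits)
  with inj_idx_shift idx_shift_mem_idx_set obtain h
    where "cyclic_vector idx_shift (idx_set k \<union> range (\<lambda>n. (idx_shift ^^ n) (Inr (k, 0)))) h"
    using g by (rule cyclic_vector_adjoin_orbit)
  then show ?case unfolding idx_set_Suc by blast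
qed

theorem mainTheorem19:
  fixes k :: nat
  assumes "k \<ge> 1"
  shows "cyclic_op (H_space k) T_op"
proof -
  obtain g where "cyclic_vector idx_shift (idx_set k) g"
    using cyclic_vector_idx_shift by blast
  then show ?thesis
    unfolding H_space_eq_ell2_on T_op_eq_comp by (rule cyclic_op_comp)
qed

end
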